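(* For every triangle-free graph $G$, for every integer $k>\chi'(G)$, every $\chi'(G)$-edge-colouring of $G$ can be reached from every $k$-edge-colouring of $G$ through a series of Kempe changes (using colours from $\{1,\ldots,k\}$).
   Context: Graphs are finite and simple. A $k$-edge-colouring of $G$ is a proper edge-colouring with colours in $\{1,\ldots,k\}$, i.e. a map $E(G)\to\{1,\ldots,k\}$ giving distinct colours to any two distinct edges sharing an endpoint (not every colour has to be used; in particular a $\chi'(G)$-edge-colouring, with colours in $\{1,\ldots,\chi'(G)\}$, is also a $k$-edge-colouring for $k>\chi'(G)$). The chromatic index $\chi'(G)$ is the smallest integer $k$ such that $G$ admits a $k$-edge-colouring. Given a $k$-edge-colouring, a Kempe chain is a maximal connected bicoloured subgraph, i.e. a connected component of the subgraph formed by all edges coloured $c$ or $d$, for two distinct colours $c,d\in\{1,\ldots,k\}$; it may consist of a single edge (coloured $c$, when $d$ appears on no edge incident to it). A Kempe change consists in selecting a Kempe chain and swapping its two colours $c$ and $d$ on it. A colouring is reached from another through a series of Kempe changes if it is obtained from it by a finite (possibly empty) sequence of Kempe changes. *)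

theory Defs
  imports "HOL-Library.FuncSet" "HOL-Combinatorics.Transposition"
begin

definition simple_graph :: "'a set \<Rightarrow> 'a set set \<Rightarrow> bool" where
  "simple_graph V E \<longleftrightarrow> finite V \<and> (\<forall>e\<in>E. e \<subseteq> V \<and> card e = 2)"

(* The three vertices need not be required distinct: no singleton is an edge of a simple graph. *)
definition triangle_free :: "'a set set \<Rightarrow> bool" where
  "triangle_free E \<longleftrightarrow> \<not> (\<exists>x y z. {x, y} \<in> E \<and> {y, z} \<in> E \<and> {x, z} \<in> E)"

(* The extensional function space identifies two colourings that agree on E, so that equality of
   colourings is equality of maps on the edge set. *)
definition edge_colouring :: "'a set set \<Rightarrow> nat \<Rightarrow> ('a set \<Rightarrow> nat) \<Rightarrow> bool" where
  "edge_colouring E k f \<longleftrightarrow>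
     f \<in> E \<rightarrow>\<^sub>E {1..k} \<and>
     (\<forall>e\<in>E. \<forall>e'\<in>E. e \<noteq> e' \<and> e \<inter> e' \<noteq> {} \<longrightarrow> f e \<noteq> f e')"

(* The minimum exists for every finite simple graph, as colouring all edges differently is proper. *)
definition chromatic_index :: "'a set set \<Rightarrow> nat" where
  "chromatic_index E = (LEAST k. \<exists>f. edge_colouring E k f)"

definition bicoloured_edges :: "'a set set \<Rightarrow> ('a set \<Rightarrow> nat) \<Rightarrow> nat \<Rightarrow> nat \<Rightarrow> 'a set set" where
  "bicoloured_edges E f c d = {e \<in> E. f e = c \<or> f e = d}"

definition component_vertices :: "'a set set \<Rightarrow> 'a \<Rightarrow> 'a set" where
  "component_vertices H v = {(x, y). {x, y} \<in> H}\<^sup>* `` {v}"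

(* K is the edge set of a Kempe chain. The vertices of the bicoloured subgraph H are the endpoints
   of its edges, hence v ranges over the union of H and every chain has at least one edge. *)
definition kempe_chain ::
    "'a set set \<Rightarrow> ('a set \<Rightarrow> nat) \<Rightarrow> nat \<Rightarrow> nat \<Rightarrow> 'a set set \<Rightarrow> bool" where
  "kempe_chain E f c d K \<longleftrightarrow>
     (let H = bicoloured_edges E f c d
      in \<exists>v\<in>\<Union>H. K = {e \<in> H. e \<subseteq> component_vertices H v})"

definition kempe_swap ::
    "nat \<Rightarrow> nat \<Rightarrow> 'a set set \<Rightarrow> ('a set \<Rightarrow> nat) \<Rightarrow> 'a set \<Rightarrow> nat" where
  "kempe_swap c d K f = (\<lambda>e. if e \<in> K then transpose c d (f e) else f e)"

definition kempe_change ::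
    "'a set set \<Rightarrow> nat \<Rightarrow> ('a set \<Rightarrow> nat) \<Rightarrow> ('a set \<Rightarrow> nat) \<Rightarrow> bool" where
  "kempe_change E k f g \<longleftrightarrow>
     (\<exists>c\<in>{1..k}. \<exists>d\<in>{1..k}. \<exists>K.
        c \<noteq> d \<and> kempe_chain E f c d K \<and> g = kempe_swap c d K f)"

(* The second colouring is obtained from the first. *)
definition kempe_reachable ::
    "'a set set \<Rightarrow> nat \<Rightarrow> ('a set \<Rightarrow> nat) \<Rightarrow> ('a set \<Rightarrow> nat) \<Rightarrow> bool" where
  "kempe_reachable E k = (kempe_change E k)\<^sup>*\<^sup>*"

end

theory Submission
  imports Defs
begin

text \<open>
  By induction on the number \<open>d\<close> of colours of the target colouring \<open>g\<close>, it suffices to reach from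
  \<open>f\<close> a colouring in which the last colour class \<open>M\<close> of \<open>g\<close> is exactly the class of the colour
  \<open>t = k\<close>. Call an edge ugly if it is coloured \<open>t\<close> but not in \<open>M\<close>, and bad if it is in \<open>M\<close> but not
  coloured \<open>t\<close>, and minimise first the number of ugly edges, then that of bad edges.

  In a minimal colouring, the Vizing fans around both ends of an ugly edge, started at this edge,
  are cycles, hence contain a vertex \<open>s\<close> missing only \<open>t\<close>. This \<open>s\<close> is on a bad edge \<open>{s, v}\<close>, and
  \<open>v\<close> is on an ugly edge \<open>{v, w}\<close>. The fan cycle around \<open>w\<close> can be shifted by Kempe changes, which
  moves the ugly edge \<open>{v, w}\<close> to another edge \<open>{w, q}\<close>; as there are no triangles, \<open>q \<noteq> s\<close>, so now
  both \<open>s\<close> and \<open>v\<close> miss \<open>t\<close> and \<open>{s, v}\<close> can be recoloured with \<open>t\<close>, a contradiction.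
\<close>

section \<open>Missing colours, swaps on vertex sets and shifts at a vertex\<close>

definition missing :: "'a set set \<Rightarrow> nat \<Rightarrow> ('a set \<Rightarrow> nat) \<Rightarrow> 'a \<Rightarrow> nat set" where
  "missing E k f x = {c \<in> {1..k}. \<forall>e\<in>E. x \<in> e \<longrightarrow> f e \<noteq> c}"

text \<open>In a graph, such a \<open>C\<close> is a union of components of the subgraph in the
  colours \<open>c\<close> and \<open>d\<close>, so that a swap on \<open>C\<close> is a swap of
  several disjoint Kempe chains. Vertices on no such edge may be added freely.\<close>

definition closed_for :: "'a set set \<Rightarrow> ('a set \<Rightarrow> nat) \<Rightarrow> nat \<Rightarrow> nat \<Rightarrow> 'a set \<Rightarrow> bool" where
  "closed_for E f c d C \<longleftrightarrow> (\<forall>e\<in>E. (f e = c \<or> f e = d) \<and> e \<inter> C \<noteq> {} \<longrightarrow> e \<subseteq> C)"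

text \<open>All edges meeting \<open>C\<close> are treated alike, as the transposition fixes the
  other colours. For closed \<open>C\<close>, the effect at a vertex depends only on whether it lies
  in \<open>C\<close>.\<close>

definition vertex_swap ::
    "'a set set \<Rightarrow> nat \<Rightarrow> nat \<Rightarrow> 'a set \<Rightarrow> ('a set \<Rightarrow> nat) \<Rightarrow> 'a set \<Rightarrow> nat" where
  "vertex_swap E c d C f = (\<lambda>e. if e \<in> E \<and> e \<inter> C \<noteq> {} then transpose c d (f e) else f e)"

text \<open>The vertex set of a Kempe chain, or just \<open>{x}\<close> when \<open>x\<close> is on
  no edge coloured \<open>c\<close> or \<open>d\<close>.\<close>

definition bicomponent :: "'a set set \<Rightarrow> ('a set \<Rightarrow> nat) \<Rightarrow> nat \<Rightarrow> nat \<Rightarrow> 'a \<Rightarrow> 'a set" where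
  "bicomponent E f c d x = component_vertices (bicoloured_edges E f c d) x"

text \<open>On a fan, \<open>m x\<close> is the colour of the edge after \<open>{v, x}\<close>, so
  each colour moves to the preceding edge, and the last edge receives
  \<open>m (last ws)\<close>.\<close>

definition shift :: "('a set \<Rightarrow> nat) \<Rightarrow> 'a \<Rightarrow> ('a \<Rightarrow> nat) \<Rightarrow> 'a list \<Rightarrow> 'a set \<Rightarrow> nat" where
  "shift f v m ws = foldr (\<lambda>x g. g({v, x} := m x)) ws f"

lemma shift_simps [simp]:
  "shift f v m [] = f"
  "shift f v m (x # xs) = (shift f v m xs)({v, x} := m x)"
  by (simp_all add: shift_def)

text \<open>Order and repetition do not matter, since each entry writes its own colour on its own
  edge. Hence a fan cycle can be shifted from any of its vertices.\<close>

lemma shift_in: "x \<in> set ws \<Longrightarrow> shift f v m ws {v, x} = m x"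
  by (induction ws) (auto simp: doubleton_eq_iff)

lemma shift_notin: "(\<And>x. x \<in> set ws \<Longrightarrow> e \<noteq> {v, x}) \<Longrightarrow> shift f v m ws e = f e"
  by (induction ws) auto

lemma shift_cases:
  obtains x where "x \<in> set ws" "e = {v, x}" "shift f v m ws e = m x"
  | "\<And>x. x \<in> set ws \<Longrightarrow> e \<noteq> {v, x}" "shift f v m ws e = f e"
  using shift_in shift_notin by metis

lemma kempe_reachable_refl [simp]: "kempe_reachable E k f f"
  by (simp add: kempe_reachable_def)

lemma kempe_reachable_trans [trans]:
  "kempe_reachable E k f g \<Longrightarrow> kempe_reachable E k g h \<Longrightarrow> kempe_reachable E k f h"
  by (simp add: kempe_reachable_def)

lemma edge_colouringD:
  assumes "edge_colouring E k f" "e \<in> E" "e' \<in> E" "x \<in> e" "x \<in> e'" "f e = f e'"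
  shows "e = e'"
  using assms unfolding edge_colouring_def by blast

lemma edge_colouring_range:
  assumes "edge_colouring E k f" "e \<in> E"
  shows "f e \<in> {1..k}"
  using assms unfolding edge_colouring_def by auto

lemma missingD: "c \<in> missing E k f x \<Longrightarrow> e \<in> E \<Longrightarrow> x \<in> e \<Longrightarrow> f e \<noteq> c"
  by (simp add: missing_def)

lemma missing_range: "c \<in> missing E k f x \<Longrightarrow> c \<in> {1..k}"
  by (simp add: missing_def)

lemma not_missing:
  assumes "c \<in> {1..k}" "c \<notin> missing E k f x"
  obtains e where "e \<in> E" "x \<in> e" "f e = c"
  using assms by (auto simp: missing_def)

lemma closed_forD:
  "closed_for E f c d C \<Longrightarrow> e \<in> E \<Longrightarrow> f e = c \<or> f e = d \<Longrightarrow> x \<in> e \<Longrightarrow> x \<in> C \<Longrightarrow> y \<in> e \<Longrightarrow> y \<in> C"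
  unfolding closed_for_def by blast

lemma vertex_swap_colour:
  "vertex_swap E c d C f e = c \<or> vertex_swap E c d C f e = d \<longleftrightarrow> f e = c \<or> f e = d"
  by (auto simp: vertex_swap_def transpose_def)

lemma closed_for_vertex_swap:
  "closed_for E (vertex_swap E c d C f) c d D \<longleftrightarrow> closed_for E f c d D"
  unfolding closed_for_def vertex_swap_colour ..

lemma vertex_swap_at:
  assumes "closed_for E f c d C" "e \<in> E" "x \<in> e"
  shows "vertex_swap E c d C f e = (if x \<in> C then transpose c d (f e) else f e)"
proof (cases "f e = c \<or> f e = d")
  case True
  then show ?thesis using assms by (auto simp: vertex_swap_def closed_for_def)
next
  case False
  then show ?thesis by (auto simp: vertex_swap_def transpose_def)
qed

lemma edge_colouring_vertex_swap:
  assumes f: "edge_colouring E k f" and C: "closed_for E f c d C"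
    and cd: "c \<in> {1..k}" "d \<in> {1..k}"
  shows "edge_colouring E k (vertex_swap E c d C f)"
  unfolding edge_colouring_def
proof (intro conjI ballI impI)
  show "vertex_swap E c d C f \<in> E \<rightarrow>\<^sub>E {1..k}"
    using f cd unfolding edge_colouring_def vertex_swap_def transpose_def
    by (auto simp: PiE_iff extensional_def)
next
  fix e e' assume e: "e \<in> E" "e' \<in> E" "e \<noteq> e' \<and> e \<inter> e' \<noteq> {}"
  then obtain x where x: "x \<in> e" "x \<in> e'" by auto
  have "f e \<noteq> f e'" using edge_colouringD[OF f e(1,2) x] e by blast
  then show "vertex_swap E c d C f e \<noteq> vertex_swap E c d C f e'"
    using vertex_swap_at[OF C e(1) x(1)] vertex_swap_at[OF C e(2) x(2)]
    by (auto dest: injD[OF inj_transpose])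
qed

lemma missing_vertex_swap_out:
  assumes "closed_for E f c d C" "x \<notin> C"
  shows "missing E k (vertex_swap E c d C f) x = missing E k f x"
  using vertex_swap_at[OF assms(1)] assms(2) by (auto simp: missing_def)

lemma missing_vertex_swap_in:
  assumes "closed_for E f c d C" "x \<in> C" "c \<in> {1..k}" "d \<in> {1..k}"
  shows "a \<in> missing E k (vertex_swap E c d C f) x \<longleftrightarrow> transpose c d a \<in> missing E k f x"
proof -
  have "transpose c d a \<in> {1..k} \<longleftrightarrow> a \<in> {1..k}" using assms(3,4) by (auto simp: transpose_def)
  moreover have "transpose c d (f e) = a \<longleftrightarrow> f e = transpose c d a" for e
    by (metis transpose_involutory)
  ultimately show ?thesis
    using vertex_swap_at[OF assms(1)] assms(2) by (auto simp: missing_def)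
qed

lemma missing_vertex_swap_other:
  assumes "closed_for E f c d C" "a \<noteq> c" "a \<noteq> d"
  shows "a \<in> missing E k (vertex_swap E c d C f) x \<longleftrightarrow> a \<in> missing E k f x"
proof -
  have "vertex_swap E c d C f e = a \<longleftrightarrow> f e = a" for e
    using assms(2,3) by (auto simp: vertex_swap_def transpose_def)
  then show ?thesis by (simp add: missing_def)
qed

section \<open>Bicoloured components and Kempe changes\<close>

lemma bicomponent_self: "x \<in> bicomponent E f c d x"
  by (simp add: bicomponent_def component_vertices_def)

lemma bicomponent_commute: "bicomponent E f c d x = bicomponent E f d c x"
  by (simp add: bicomponent_def bicoloured_edges_def disj_commute)

lemma bicomponent_sym:
  assumes "y \<in> bicomponent E f c d x"
  shows "x \<in> bicomponent E f c d y"
proof -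
  have "sym {(x, y). {x, y} \<in> bicoloured_edges E f c d}"
    by (auto simp: sym_def insert_commute)
  then show ?thesis
    using assms symD[OF sym_rtrancl] unfolding bicomponent_def component_vertices_def by fastforce
qed

lemma vertex_swap_involutory [simp]:
  "vertex_swap E c d C (vertex_swap E c d C f) = f"
  by (auto simp: vertex_swap_def)

lemma bicomponent_subset:
  assumes "closed_for E f c d C" "x \<in> C"
  shows "bicomponent E f c d x \<subseteq> C"
proof
  fix y assume "y \<in> bicomponent E f c d x"
  then have "(x, y) \<in> {(x, y). {x, y} \<in> bicoloured_edges E f c d}\<^sup>*"
    by (simp add: bicomponent_def component_vertices_def)
  then show "y \<in> C"
  proof (induction rule: rtrancl_induct)
    case base show ?case by fact
  next
    case (step y z)
    then show ?case using closed_forD[OF assms(1), of "{y, z}" y z] by (auto simp: bicoloured_edges_def)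
  qed
qed

locale fin_graph =
  fixes E :: "'a set set"
  assumes finite_E: "finite E" and card_E: "\<And>e. e \<in> E \<Longrightarrow> card e = 2"
begin

lemma edge_at:
  assumes "e \<in> E" "x \<in> e"
  obtains y where "e = {x, y}" "x \<noteq> y"
  using card_E[OF assms(1)] assms(2) by (auto simp: card_2_iff)

lemma edge_neq: "{x, y} \<in> E \<Longrightarrow> x \<noteq> y"
  using card_E[of "{x, y}"] by auto

lemma closed_bicomponent: "closed_for E f c d (bicomponent E f c d x)"
  unfolding closed_for_def
proof (intro ballI impI subsetI)
  fix e y assume e: "e \<in> E" "(f e = c \<or> f e = d) \<and> e \<inter> bicomponent E f c d x \<noteq> {}" "y \<in> e"
  then obtain z where z: "z \<in> e" "z \<in> bicomponent E f c d x" by auto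
  show "y \<in> bicomponent E f c d x"
  proof (cases "y = z")
    case False
    then have "e = {z, y}" using edge_at[OF e(1) z(1)] e(3) by blast
    then show ?thesis using z e unfolding bicomponent_def component_vertices_def bicoloured_edges_def
      by (auto intro: rtrancl_into_rtrancl)
  qed (use z in simp)
qed

text \<open>A bicoloured edge meeting the component lies inside it, and edges of other colours are
  fixed by the transposition.\<close>

lemma kempe_swap_bicomponent:
  assumes "K = {e \<in> bicoloured_edges E f c d. e \<subseteq> component_vertices (bicoloured_edges E f c d) x}"
  shows "kempe_swap c d K f = vertex_swap E c d (bicomponent E f c d x) f"
proof
  fix e
  let ?C = "bicomponent E f c d x"
  show "kempe_swap c d K f e = vertex_swap E c d ?C f e"
  proof (cases "e \<in> bicoloured_edges E f c d")
    case True
    then have e: "e \<in> E" "f e = c \<or> f e = d" by (auto simp: bicoloured_edges_def)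
    then obtain y where "y \<in> e" using card_E[of e] by fastforce
    then have "e \<inter> ?C \<noteq> {} \<longleftrightarrow> e \<subseteq> ?C"
      using closed_bicomponent[of f c d x] e unfolding closed_for_def by blast
    then show ?thesis using True e assms
      by (simp add: vertex_swap_def kempe_swap_def bicomponent_def[symmetric])
  next
    case False
    then show ?thesis using assms
      by (auto simp: vertex_swap_def kempe_swap_def bicoloured_edges_def transpose_def)
  qed
qed

lemma edge_colouring_reachable:
  assumes "kempe_reachable E k f g" "edge_colouring E k f"
  shows "edge_colouring E k g"
  using assms unfolding kempe_reachable_def
proof (induction rule: rtranclp_induct)
  case (step g h)
  obtain c d x where cd: "c \<in> {1..k}" "d \<in> {1..k}"
    and h: "h = kempe_swap c d {e \<in> bicoloured_edges E g c d.
      e \<subseteq> component_vertices (bicoloured_edges E g c d) x} g"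
    using step(2) unfolding kempe_change_def kempe_chain_def Let_def by blast
  show ?case
    unfolding h kempe_swap_bicomponent[OF refl]
    by (rule edge_colouring_vertex_swap[OF step(3)[OF step(4)] closed_bicomponent cd])
qed

text \<open>The chains inside \<open>C\<close> are swapped one after another: once the chain through
  \<open>x\<close> is done, the rest of \<open>C\<close> is still closed and meets fewer bicoloured
  edges.\<close>

lemma reachable_vertex_swap:
  assumes "edge_colouring E k f" "closed_for E f c d C" "c \<in> {1..k}" "d \<in> {1..k}" "c \<noteq> d"
  shows "kempe_reachable E k f (vertex_swap E c d C f)"
  using assms(1,2)
proof (induction "card {e \<in> bicoloured_edges E f c d. e \<inter> C \<noteq> {}}" arbitrary: f C rule: less_induct)
  case less
  let ?H = "bicoloured_edges E f c d"
  let ?T = "\<lambda>f C. {e \<in> bicoloured_edges E f c d. e \<inter> C \<noteq> {}}"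
  show ?case
  proof (cases "?T f C = {}")
    case True
    have "vertex_swap E c d C f = f"
    proof
      fix e
      show "vertex_swap E c d C f e = f e"
        using True by (cases "f e = c \<or> f e = d")
          (auto simp: vertex_swap_def bicoloured_edges_def transpose_def)
    qed
    then show ?thesis by simp
  next
    case False
    then obtain e x where e: "e \<in> ?H" "x \<in> e" "x \<in> C" by auto
    let ?K = "bicomponent E f c d x"
    let ?f = "vertex_swap E c d ?K f"
    have sub: "?K \<subseteq> C" using bicomponent_subset[OF less.prems(2) e(3)] .
    have cl: "closed_for E f c d ?K" by (rule closed_bicomponent)
    have eq: "?f = kempe_swap c d {e \<in> ?H. e \<subseteq> component_vertices ?H x} f"
      by (rule kempe_swap_bicomponent[OF refl, symmetric])
    \<comment> \<open>A chain must start at a vertex of some bicoloured edge; here \<open>e\<close>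
      contains \<open>x\<close>.\<close>
    have "kempe_chain E f c d {e \<in> ?H. e \<subseteq> component_vertices ?H x}"
      unfolding kempe_chain_def Let_def using e by blast
    then have "kempe_change E k f ?f" unfolding kempe_change_def eq using assms by blast
    then have 1: "kempe_reachable E k f ?f" by (simp add: kempe_reachable_def)
    have colf: "edge_colouring E k ?f"
      using edge_colouring_vertex_swap[OF less.prems(1) cl assms(3,4)] .
    have H: "bicoloured_edges E ?f c d = ?H"
      unfolding bicoloured_edges_def vertex_swap_colour ..
    have cl': "closed_for E ?f c d (C - ?K)"
      unfolding closed_for_vertex_swap using less.prems(2) cl unfolding closed_for_def by blast
    have "?T ?f (C - ?K) \<subset> ?T f C" unfolding H
    proof
      show "{e \<in> ?H. e \<inter> (C - ?K) \<noteq> {}} \<subseteq> ?T f C" by blast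
      have "e \<subseteq> ?K"
        using cl e bicomponent_self[of x E f c d] unfolding closed_for_def bicoloured_edges_def by blast
      then show "{e \<in> ?H. e \<inter> (C - ?K) \<noteq> {}} \<noteq> ?T f C" using e by blast
    qed
    moreover have "finite (?T f C)" using finite_E by (simp add: bicoloured_edges_def)
    ultimately have "card (?T ?f (C - ?K)) < card (?T f C)" by (rule psubset_card_mono[rotated])
    from less.hyps[OF this colf cl']
    have 2: "kempe_reachable E k ?f (vertex_swap E c d (C - ?K) ?f)" .
    \<comment> \<open>A bicoloured edge that meets \<open>C\<close> lies inside exactly one of
      \<open>?K\<close> and \<open>C - ?K\<close>, so it is swapped exactly once.\<close>
    have "vertex_swap E c d (C - ?K) ?f = vertex_swap E c d C f"
    proof
      fix e'
      show "vertex_swap E c d (C - ?K) ?f e' = vertex_swap E c d C f e'"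
      proof (cases "e' \<in> ?H")
        case True
        then have e': "e' \<in> E" "f e' = c \<or> f e' = d" by (auto simp: bicoloured_edges_def)
        then have "e' \<inter> C \<noteq> {} \<longrightarrow> e' \<subseteq> C" "e' \<inter> ?K \<noteq> {} \<longrightarrow> e' \<subseteq> ?K"
          using less.prems(2) cl unfolding closed_for_def by blast+
        then show ?thesis using sub unfolding vertex_swap_def by auto
      next
        case False
        then show ?thesis
          by (auto simp: vertex_swap_def bicoloured_edges_def transpose_def)
      qed
    qed
    then show ?thesis using 1 2 kempe_reachable_trans by metis
  qed
qed


end

section \<open>Ends of bicoloured chains\<close>

text \<open>A component of a graph of maximum degree two is a path or a cycle, so it has at most two
  ends. Deleting the only edge at the end \<open>x\<close> makes its neighbour \<open>v\<close> an
  end, which takes the place of \<open>x\<close> in the induction.\<close>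

lemma three_ends:
  assumes "finite H" "\<And>e. e \<in> H \<Longrightarrow> card e = 2" "\<And>u. card {e \<in> H. u \<in> e} \<le> 2"
    and "card {e \<in> H. x \<in> e} \<le> 1" "card {e \<in> H. y \<in> e} \<le> 1" "card {e \<in> H. z \<in> e} \<le> 1"
    and "x \<noteq> y" "x \<noteq> z" "y \<noteq> z"
    and "y \<in> component_vertices H x" "z \<in> component_vertices H x"
  shows False
  using assms
proof (induction "card H" arbitrary: H x rule: less_induct)
  case less
  let ?R = "\<lambda>H. {(x, y). {x, y} \<in> H}"
  have xy: "(x, y) \<in> (?R H)\<^sup>*" and xz: "(x, z) \<in> (?R H)\<^sup>*"
    using less.prems by (auto simp: component_vertices_def)
  obtain v where v: "{x, v} \<in> H" using converse_rtranclE[OF xy] less.prems(7) by blast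
  have fin: "finite {e \<in> H. u \<in> e}" for u using less.prems(1) by simp
  have uniq: "e = e'" if "card {e \<in> H. u \<in> e} \<le> 1" "e \<in> H" "e' \<in> H" "u \<in> e" "u \<in> e'" for u e e'
    using that card_le_Suc0_iff_eq[OF fin[of u]] by auto
  have xv: "x \<noteq> v" using less.prems(2)[OF v] by auto
  let ?H = "H - {{x, v}}"
  have deg: "{e \<in> ?H. u \<in> e} \<subseteq> {e \<in> H. u \<in> e}" for u by blast
  have dv: "card {e \<in> ?H. v \<in> e} \<le> 1"
  proof -
    have "{e \<in> ?H. v \<in> e} = {e \<in> H. v \<in> e} - {{x, v}}" by blast
    then have "card {e \<in> ?H. v \<in> e} = card {e \<in> H. v \<in> e} - 1"
      using v fin by (simp add: card_Diff_singleton_if)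
    then show ?thesis using less.prems(3)[of v] by simp
  qed
  \<comment> \<open>A walk can leave or enter \<open>x\<close> only through \<open>{x, v}\<close>,
    so what it reaches other than \<open>x\<close> is reached from \<open>v\<close> without this
    edge.\<close>
  have reach: "u = x \<or> (v, u) \<in> (?R ?H)\<^sup>*" if "(x, u) \<in> (?R H)\<^sup>*" for u
    using that
  proof (induction rule: rtrancl_induct)
    case (step u u')
    then have uu': "{u, u'} \<in> H" by simp
    show ?case
    proof (cases "u = x \<or> u' = x")
      case True
      then have "{u, u'} = {x, v}" using uniq[OF less.prems(4) uu' v] by blast
      then show ?thesis using True by (auto simp: doubleton_eq_iff)
    next
      case False
      then have "{u, u'} \<noteq> {x, v}" by (auto simp: doubleton_eq_iff)
      then have "(u, u') \<in> ?R ?H" using uu' by simp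
      then show ?thesis using step.IH False by (meson rtrancl.rtrancl_into_rtrancl)
    qed
  qed simp
  have vy: "(v, y) \<in> (?R ?H)\<^sup>*" and vz: "(v, z) \<in> (?R ?H)\<^sup>*"
    using reach xy xz less.prems by blast+
  \<comment> \<open>If \<open>v\<close> were itself \<open>y\<close> or \<open>z\<close>, then
    \<open>{x, v}\<close> would be its only edge, and it would be isolated after the
    deletion.\<close>
  have end_iso: "u = u'" if u: "card {e \<in> H. u \<in> e} \<le> 1" "v = u" "(v, u') \<in> (?R ?H)\<^sup>*" for u u'
  proof (rule ccontr)
    assume "u \<noteq> u'"
    then obtain b where "{v, b} \<in> ?H" using converse_rtranclE[OF u(3)] u(2) by blast
    then show False using uniq[OF u(1), of "{v, b}" "{x, v}"] v u(2) by blast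
  qed
  have ny: "v \<noteq> y" and nz: "v \<noteq> z"
    using end_iso[OF less.prems(5) _ vz] end_iso[OF less.prems(6) _ vy] less.prems(9) by blast+
  have c: "card ?H < card H" using v less.prems(1) by (meson card_Diff1_less)
  show False
  proof (rule less.hyps[OF c, of v])
    show "card {e \<in> ?H. u \<in> e} \<le> 2" for u
      using card_mono[OF fin deg, of u] less.prems(3)[of u] by linarith
    show "card {e \<in> ?H. y \<in> e} \<le> 1" "card {e \<in> ?H. z \<in> e} \<le> 1"
      using card_mono[OF fin deg, of y] card_mono[OF fin deg, of z] less.prems(5,6) by linarith+
    show "y \<in> component_vertices ?H v" "z \<in> component_vertices ?H v"
      using vy vz by (simp_all add: component_vertices_def)
    show "card {e \<in> ?H. v \<in> e} \<le> 1" by (rule dv)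
    show "v \<noteq> y" "v \<noteq> z" "y \<noteq> z" by (fact ny, fact nz, rule less.prems(9))
  qed (use less.prems(1,2) in simp_all)
qed

context fin_graph
begin

text \<open>Each colour occurs at most once at a vertex, so a vertex missing \<open>c\<close> or
  \<open>d\<close> has degree at most one in the bicoloured subgraph.\<close>

lemma bicomponent_ends:
  assumes f: "edge_colouring E k f"
    and x: "c \<in> missing E k f x \<or> d \<in> missing E k f x"
    and y: "c \<in> missing E k f y \<or> d \<in> missing E k f y"
    and z: "c \<in> missing E k f z \<or> d \<in> missing E k f z"
    and "x \<noteq> y" "x \<noteq> z" "y \<noteq> z"
    and "y \<in> bicomponent E f c d x" "z \<in> bicomponent E f c d x"
  shows False
proof (rule three_ends[of "bicoloured_edges E f c d" x y z])
  let ?H = "bicoloured_edges E f c d"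
  have one: "card {e \<in> E. u \<in> e \<and> f e = a} \<le> 1" for u a
  proof -
    have "finite {e \<in> E. u \<in> e \<and> f e = a}" using finite_E by simp
    then show ?thesis using edge_colouringD[OF f] by (auto simp: card_le_Suc0_iff_eq)
  qed
  have split: "{e \<in> ?H. u \<in> e} = {e \<in> E. u \<in> e \<and> f e = c} \<union> {e \<in> E. u \<in> e \<and> f e = d}" for u
    by (auto simp: bicoloured_edges_def)
  show "card {e \<in> ?H. u \<in> e} \<le> 2" for u
    unfolding split
    using card_Un_le[of "{e \<in> E. u \<in> e \<and> f e = c}" "{e \<in> E. u \<in> e \<and> f e = d}"] one[of u c] one[of u d]
    by linarith
  have le1: "card {e \<in> ?H. u \<in> e} \<le> 1" if "c \<in> missing E k f u \<or> d \<in> missing E k f u" for u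
  proof -
    have "{e \<in> E. u \<in> e \<and> f e = c} = {} \<or> {e \<in> E. u \<in> e \<and> f e = d} = {}"
      using that by (auto simp: missing_def)
    then show ?thesis
      unfolding split using one[of u c] one[of u d] by (elim disjE) (simp_all only: Un_empty_left Un_empty_right)
  qed
  show "card {e \<in> ?H. x \<in> e} \<le> 1" "card {e \<in> ?H. y \<in> e} \<le> 1" "card {e \<in> ?H. z \<in> e} \<le> 1"
    using le1 x y z by blast+
  show "y \<in> component_vertices ?H x" "z \<in> component_vertices ?H x"
    using assms(8,9) by (simp_all add: bicomponent_def)
  show "finite ?H" using finite_E by (simp add: bicoloured_edges_def)
  show "card e = 2" if "e \<in> ?H" for e using card_E that by (simp add: bicoloured_edges_def)
qed fact+

text \<open>The edge \<open>{v, w}\<close> alone is a Kempe chain in its colour and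
  \<open>d\<close>. The second claim says that its old colour becomes free at
  \<open>v\<close>.\<close>

lemma recolour_edge:
  assumes f: "edge_colouring E k f" and e: "{v, w} \<in> E"
    and d: "d \<in> missing E k f v" "d \<in> missing E k f w"
  shows "kempe_reachable E k f (f({v, w} := d))"
    and "f {v, w} \<in> missing E k (f({v, w} := d)) v"
proof -
  let ?c = "f {v, w}"
  have cd: "?c \<noteq> d" using missingD[OF d(1) e] by simp
  have only: "e' = {v, w}" if "e' \<in> E" "f e' = ?c \<or> f e' = d" "e' \<inter> {v, w} \<noteq> {}" for e'
    using that edge_colouringD[OF f \<open>e' \<in> E\<close> e] missingD[OF d(1)] missingD[OF d(2)] by blast
  have "closed_for E f ?c d {v, w}" unfolding closed_for_def using only by blast
  moreover have "vertex_swap E ?c d {v, w} f = f({v, w} := d)"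
  proof
    fix e'
    show "vertex_swap E ?c d {v, w} f e' = (f({v, w} := d)) e'"
      using e only[of e'] by (auto simp: vertex_swap_def transpose_def)
  qed
  ultimately show "kempe_reachable E k f (f({v, w} := d))"
    using reachable_vertex_swap[OF f, of ?c d "{v, w}"] edge_colouring_range[OF f e]
      missing_range[OF d(1)] cd by simp
  show "?c \<in> missing E k (f({v, w} := d)) v"
    unfolding missing_def
  proof (intro CollectI conjI ballI impI)
    fix e' assume e': "e' \<in> E" "v \<in> e'"
    then have "e' \<noteq> {v, w} \<Longrightarrow> f e' \<noteq> ?c" using only[of e'] by blast
    then show "(f({v, w} := d)) e' \<noteq> ?c" using cd by simp
  qed (rule edge_colouring_range[OF f e])
qed

end

section \<open>Vizing fans\<close>

lemma missing_cong:
  "(\<And>e. e \<in> E \<Longrightarrow> x \<in> e \<Longrightarrow> f e = g e) \<Longrightarrow> missing E k f x = missing E k g x"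
  by (auto simp: missing_def)

text \<open>The missing colours are chosen by one function \<open>m\<close> on vertices, so that
  several fans can share the choice. The definition leaves \<open>m (last ws)\<close> open: the fan
  is a path if this colour is missing at \<open>v\<close>, and a cycle if it is the colour of the
  first edge.\<close>

definition fan :: "'a set set \<Rightarrow> nat \<Rightarrow> ('a set \<Rightarrow> nat) \<Rightarrow> 'a \<Rightarrow> ('a \<Rightarrow> nat) \<Rightarrow> 'a list \<Rightarrow> bool" where
  "fan E k f v m ws \<longleftrightarrow> distinct ws \<and> ws \<noteq> [] \<and>
     (\<forall>x\<in>set ws. {v, x} \<in> E \<and> m x \<in> missing E k f x) \<and>
     successively (\<lambda>x y. f {v, y} = m x) ws"

lemma successively_mono_last:
  assumes "successively P ws" "distinct ws"
    and "\<And>x y. x \<in> set ws \<Longrightarrow> y \<in> set ws \<Longrightarrow> x \<noteq> last ws \<Longrightarrow> y \<noteq> hd ws \<Longrightarrow> P x y \<Longrightarrow> Q x y"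
  shows "successively Q ws"
  using assms
proof (induction ws rule: induct_list012)
  case (3 x y zs)
  have "successively Q (y # zs)"
    by (rule "3.IH"(2)) (use 3 in auto)
  then show ?case using "3.prems" last_in_set[of "y # zs"] by auto
qed auto

lemma successively_succ:
  assumes "successively P ws" "distinct ws" "x \<in> set ws" "x \<noteq> last ws"
  obtains y where "y \<in> set ws" "y \<noteq> hd ws" "P x y"
proof -
  obtain us vs where ws: "ws = us @ x # vs" using assms(3) by (meson split_list)
  with assms(4) obtain y vs' where "vs = y # vs'" by (cases vs) auto
  moreover from this have "P x y"
    using assms(1) ws by (auto simp: successively_append_iff successively_Cons)
  ultimately show ?thesis using that[of y] assms(2) ws by (cases us) auto
qed

text \<open>No link of the fan involves the colour of its first edge or the chosen colour of its
  last vertex, so these two may change, as long as the choices remain missing.\<close>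

lemma fan_cong:
  assumes "fan E k f v m ws"
    and "\<And>x. x \<in> set ws \<Longrightarrow> x \<noteq> hd ws \<Longrightarrow> g {v, x} = f {v, x}"
    and "\<And>x. x \<in> set ws \<Longrightarrow> x \<noteq> last ws \<Longrightarrow> n x = m x"
    and "\<And>x. x \<in> set ws \<Longrightarrow> n x \<in> missing E k g x"
  shows "fan E k g v n ws"
  unfolding fan_def
proof (intro conjI)
  show "successively (\<lambda>x y. g {v, y} = n x) ws"
    by (rule successively_mono_last[of "\<lambda>x y. f {v, y} = m x"])
      (use assms in \<open>auto simp: fan_def\<close>)
qed (use assms in \<open>auto simp: fan_def\<close>)

lemma fan_prefix: "fan E k f v m (us @ x # vs) \<Longrightarrow> fan E k f v m (us @ [x])"
  by (auto simp: fan_def successively_append_iff)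

lemma fan_tl: "fan E k f v m (x # xs) \<Longrightarrow> xs \<noteq> [] \<Longrightarrow> fan E k f v m xs"
  by (auto simp: fan_def successively_Cons)

lemma fan_suffix: "fan E k f v m (us @ x # vs) \<Longrightarrow> fan E k f v m (x # vs)"
  by (auto simp: fan_def successively_append_iff)

lemma fan_succ:
  assumes "fan E k f v m ws" "x \<in> set ws" "x \<noteq> last ws"
  obtains y where "y \<in> set ws" "y \<noteq> hd ws" "m x = f {v, y}"
proof -
  have "successively (\<lambda>x y. f {v, y} = m x) ws" "distinct ws"
    using assms(1) by (auto simp: fan_def)
  from successively_succ[OF this assms(2,3)] show ?thesis using that by metis
qed

lemma colouring_at_eq:
  assumes "edge_colouring E k f" "{v, x} \<in> E" "{v, y} \<in> E" "f {v, x} = f {v, y}"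
  shows "x = y"
  using edge_colouringD[OF assms(1-3), of v] assms(4) by (auto simp: doubleton_eq_iff)

text \<open>Before the last vertex, \<open>m x\<close> is the colour of the next edge at
  \<open>v\<close>, which is not the first edge.\<close>

lemma fan_colour_neq:
  assumes "edge_colouring E k f" "fan E k f v m ws" "x \<in> set ws" "x \<noteq> last ws"
  shows "m x \<noteq> f {v, hd ws}" "m x \<notin> missing E k f v"
proof -
  obtain y where y: "y \<in> set ws" "y \<noteq> hd ws" "m x = f {v, y}" using fan_succ[OF assms(2-4)] .
  have "{v, y} \<in> E" "{v, hd ws} \<in> E" using assms(2) y(1) by (auto simp: fan_def)
  then show "m x \<noteq> f {v, hd ws}" "m x \<notin> missing E k f v"
    using colouring_at_eq[OF assms(1)] y missingD by fastforce+
qed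

section \<open>Shifting fan paths and fan cycles\<close>

context fin_graph
begin

text \<open>Edges are recoloured from the last to the first: each recolouring frees at
  \<open>v\<close> the colour that the preceding edge needs. The second claim carries the
  induction.\<close>

lemma fan_path:
  assumes f: "edge_colouring E k f" and ws: "fan E k f v m ws" and l: "m (last ws) \<in> missing E k f v"
  shows "kempe_reachable E k f (shift f v m ws)"
    and "f {v, hd ws} \<in> missing E k (shift f v m ws) v"
proof -
  have "kempe_reachable E k f (shift f v m ws) \<and> f {v, hd ws} \<in> missing E k (shift f v m ws) v"
    using ws l
  proof (induction ws)
    case Nil
    then show ?case by (simp add: fan_def)
  next
    case (Cons x xs)
    have x: "{v, x} \<in> E" "m x \<in> missing E k f x" "x \<notin> set xs" "x \<noteq> v"
      using Cons.prems edge_neq[of v x] by (auto simp: fan_def)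
    show ?case
    proof (cases "xs = []")
      case True
      then show ?thesis
        using recolour_edge[OF f x(1) _ x(2)] Cons.prems by (simp del: fun_upd_apply)
    next
      case False
      let ?g = "shift f v m xs"
      have fx: "fan E k f v m xs" "f {v, hd xs} = m x"
        using Cons.prems False by (auto simp: fan_def successively_Cons)
      have IH: "kempe_reachable E k f ?g" "f {v, hd xs} \<in> missing E k ?g v"
        using Cons.IH[OF fx(1)] Cons.prems(2) False by auto
      have "missing E k ?g x = missing E k f x"
        by (rule missing_cong, rule shift_notin) (use x in auto)
      moreover have "?g {v, x} = f {v, x}"
        by (rule shift_notin) (use x in \<open>auto simp: doubleton_eq_iff\<close>)
      ultimately show ?thesis
        using recolour_edge[OF edge_colouring_reachable[OF IH(1) f] x(1), of "m x"] IH x fx(2)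
          kempe_reachable_trans by (auto simp del: fun_upd_apply)
    qed
  qed
  then show "kempe_reachable E k f (shift f v m ws)" "f {v, hd ws} \<in> missing E k (shift f v m ws) v"
    by blast+
qed

text \<open>No shifted edge receives the colour of the first edge: the chosen colours are those of
  other edges at \<open>v\<close>, or missing at \<open>v\<close>. Shifting a path thus only removes
  the first edge from its class.\<close>

lemma fan_path_class:
  assumes f: "edge_colouring E k f" and ws: "fan E k f v m ws" and l: "m (last ws) \<in> missing E k f v"
    and e: "e \<in> E"
  shows "shift f v m ws e = f {v, hd ws} \<longleftrightarrow> f e = f {v, hd ws} \<and> e \<noteq> {v, hd ws}"
proof -
  have E: "{v, hd ws} \<in> E" "hd ws \<in> set ws" using ws by (auto simp: fan_def)
  show ?thesis
  proof (cases rule: shift_cases[where e = e and v = v and ws = ws and f = f and m = m])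
    case (1 x)
    have "m x \<noteq> f {v, hd ws}"
      using fan_colour_neq[OF f ws 1(1)] missingD[OF l E(1)] by (cases "x = last ws") auto
    moreover have "f e = f {v, hd ws} \<Longrightarrow> e = {v, hd ws}"
      using edge_colouringD[OF f e E(1), of v] 1(2) by auto
    ultimately show ?thesis using 1 by metis
  next
    case 2
    then show ?thesis using E(2) by metis
  qed
qed

text \<open>
  Swapping the chain at the last vertex turns the cycle into a path, which can be shifted; the
  same chain, now extended by the centre, is then swapped back.
\<close>

lemma fan_cycle:
  assumes f: "edge_colouring E k f" and ws: "fan E k f v m ws" and l: "m (last ws) = f {v, hd ws}"
    and a: "a \<in> missing E k f v"
    and v: "v \<notin> bicomponent E f a (m (last ws)) (last ws)"
  shows "kempe_reachable E k f (shift f v m ws)"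
proof -
  define p where "p = last ws"
  define b where "b = m p"
  define C where "C = bicomponent E f a b p"
  define g where "g = vertex_swap E a b C f"
  \<comment> \<open>After the swap \<open>p\<close> misses \<open>a\<close> instead of
    \<open>b\<close>, and \<open>v\<close> misses \<open>a\<close> too, so the fan ends as a
    path.\<close>
  define n where "n = m(p := a)"
  define h where "h = shift g v n ws"
  have wsE: "{v, x} \<in> E" "m x \<in> missing E k f x" if "x \<in> set ws" for x
    using ws that by (auto simp: fan_def)
  have ps: "p \<in> set ws" "hd ws \<in> set ws" using ws by (auto simp: fan_def p_def)
  have vC: "v \<notin> C" using v by (simp add: C_def b_def p_def)
  have pC: "p \<in> C" by (simp add: C_def bicomponent_self)
  have bh: "f {v, hd ws} = b" using l by (simp add: b_def p_def)
  have clC: "closed_for E f a b C" unfolding C_def by (rule closed_bicomponent)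
  have ab: "a \<in> {1..k}" "b \<in> {1..k}" "a \<noteq> b"
    using missing_range[OF a] missing_range[OF wsE(2)[OF ps(1)]] missingD[OF a wsE(1)[OF ps(2)]] bh
    by (auto simp: b_def)
  have mx: "m x \<noteq> a" "m x \<noteq> b" if "x \<in> set ws" "x \<noteq> p" for x
    using fan_colour_neq[OF f ws that(1)] that(2) a bh by (auto simp: p_def)
  have g: "kempe_reachable E k f g" unfolding g_def by (rule reachable_vertex_swap[OF f clC ab])
  have colg: "edge_colouring E k g" by (rule edge_colouring_reachable[OF g f])
  have gv: "g e = f e" if "e \<in> E" "v \<in> e" for e
    unfolding g_def using vertex_swap_at[OF clC that] vC by simp
  have fang: "fan E k g v n ws"
  proof (rule fan_cong[OF ws])
    show "n x \<in> missing E k g x" if "x \<in> set ws" for x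
      using missing_vertex_swap_in[OF clC pC ab(1,2)] missing_vertex_swap_other[OF clC mx[OF that]]
        wsE(2)[OF that] by (auto simp: n_def g_def b_def)
  qed (use gv wsE in \<open>auto simp: n_def p_def\<close>)
  have na: "n (last ws) \<in> missing E k g v"
    using a missing_vertex_swap_out[OF clC vC] by (simp add: n_def p_def g_def)
  have h: "kempe_reachable E k g h" unfolding h_def by (rule fan_path(1)[OF colg fang na])
  have colh: "edge_colouring E k h" by (rule edge_colouring_reachable[OF h colg])
  have vab: "f e \<noteq> a" "f e \<noteq> b" if "e \<in> E" "v \<in> e" "\<And>x. x \<in> set ws \<Longrightarrow> e \<noteq> {v, x}" for e
    using missingD[OF a that(1,2)] edge_colouringD[OF f that(1) wsE(1)[OF ps(2)] that(2)] that(3) ps(2) bh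
    by auto
  \<comment> \<open>The only edge at \<open>v\<close> coloured \<open>a\<close> or \<open>b\<close>
    in \<open>h\<close> is \<open>{v, p}\<close>, and \<open>p\<close> is in \<open>C\<close>. The
    swap then turns its colour \<open>a\<close> into the desired \<open>b\<close>.\<close>
  have clh: "closed_for E h a b (insert v C)"
    unfolding closed_for_def
  proof (intro ballI impI)
    fix e assume e: "e \<in> E" "(h e = a \<or> h e = b) \<and> e \<inter> insert v C \<noteq> {}"
    show "e \<subseteq> insert v C"
    proof (cases rule: shift_cases[where e = e and v = v and ws = ws and f = g and m = n])
      case (1 x)
      then have "x = p" using e(2) mx[of x] by (auto simp: h_def n_def split: if_splits)
      then show ?thesis using 1 pC by simp
    next
      case 2
      then have "h e = g e" by (simp add: h_def)
      then show ?thesis using closed_for_vertex_swap[of E a b C f C] clC e vab[OF e(1) _ 2(1)] gv[OF e(1)]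
        unfolding closed_for_def g_def by auto
    qed
  qed
  have "vertex_swap E a b (insert v C) h = shift f v m ws"
  proof
    fix e
    show "vertex_swap E a b (insert v C) h e = shift f v m ws e"
    proof (cases rule: shift_cases[where e = e and v = v and ws = ws and f = g and m = n])
      case (1 x)
      have "e \<in> E" using 1 wsE by simp
      then have "vertex_swap E a b (insert v C) h e = transpose a b (n x)"
        using 1 by (simp add: vertex_swap_def h_def)
      also have "\<dots> = m x"
        using mx[OF 1(1)] by (auto simp: n_def b_def transpose_def)
      finally show ?thesis using shift_in[OF 1(1), of f v m] 1(2) by simp
    next
      case 2
      then have he: "h e = g e" by (simp add: h_def)
      have "vertex_swap E a b (insert v C) g e = f e"
        using vab[of e] 2(1) gv[of e] by (auto simp: vertex_swap_def g_def transpose_def)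
      moreover have "vertex_swap E a b (insert v C) h e = vertex_swap E a b (insert v C) g e"
        unfolding vertex_swap_def he ..
      ultimately show ?thesis using shift_notin[of ws e v f m] 2(1) by simp
    qed
  qed
  then have "kempe_reachable E k h (shift f v m ws)"
    using reachable_vertex_swap[OF colh clh ab] by simp
  then show ?thesis using g h kempe_reachable_trans by metis
qed

section \<open>Vizing's fan argument\<close>

lemma bicomponent_trans:
  assumes "y \<in> bicomponent E f c d x" "z \<in> bicomponent E f c d y"
  shows "z \<in> bicomponent E f c d x"
  using bicomponent_subset[OF closed_bicomponent assms(1)] assms(2) by blast

lemma finite_neighbours: "finite {x. {v, x} \<in> E}"
proof -
  have "finite (\<Union>E)" using finite_E card_E by (metis card.infinite finite_Union zero_neq_numeral)
  then show ?thesis by (rule finite_subset[rotated]) auto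
qed

text \<open>
  Vizing's argument: a maximal fan that neither closes up to a cycle at its first edge nor
  reaches a vertex sharing a missing colour with the centre becomes a path after one swap.
\<close>

lemma fan_dichotomy:
  assumes f: "edge_colouring E k f" and vw: "{v, w} \<in> E" and a: "a \<in> missing E k f v"
    and m: "\<And>x. {v, x} \<in> E \<Longrightarrow> m x \<in> missing E k f x"
    and stuck: "\<And>g. kempe_reachable E k f g \<Longrightarrow>
      \<exists>e\<in>E. \<not> (g e = f {v, w} \<longleftrightarrow> f e = f {v, w} \<and> e \<noteq> {v, w})"
  obtains ws where "fan E k f v m ws" "hd ws = w" "m (last ws) = f {v, w}"
proof -
  define P where "P ws \<longleftrightarrow> fan E k f v m ws \<and> hd ws = w" for ws
  have "P [w]" using vw m by (simp add: P_def fan_def)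
  moreover have "length ws < Suc (card {x. {v, x} \<in> E})" if "P ws" for ws
    using that card_mono[OF finite_neighbours[of v], of "set ws"]
    by (auto simp: P_def fan_def distinct_card[symmetric] less_Suc_eq_le)
  ultimately obtain ws where "P ws" and max: "\<And>ws'. P ws' \<Longrightarrow> length ws' \<le> length ws"
    using ex_has_greatest_nat[of P "[w]" length] by blast
  then have ws: "fan E k f v m ws" "hd ws = w" by (auto simp: P_def)
  have wsE: "{v, x} \<in> E" if "x \<in> set ws" for x using ws(1) that by (simp add: fan_def)
  have dist: "distinct ws" "ws \<noteq> []" using ws(1) by (auto simp: fan_def)
  \<comment> \<open>A path from \<open>w\<close> in a reachable colouring with the same class of
    \<open>f {v, w}\<close> could be shifted, removing just \<open>{v, w}\<close> from this class,
    against \<open>stuck\<close>.\<close>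
  have nopath: False if L: "fan E k g v n L" "hd L = w" "n (last L) \<in> missing E k g v"
    and g: "kempe_reachable E k f g" "\<And>e. e \<in> E \<Longrightarrow> g e = f {v, w} \<longleftrightarrow> f e = f {v, w}" "g {v, w} = f {v, w}"
    for g n L
  proof -
    have colg: "edge_colouring E k g" by (rule edge_colouring_reachable[OF g(1) f])
    have "kempe_reachable E k f (shift g v n L)"
      using fan_path(1)[OF colg L(1,3)] g(1) kempe_reachable_trans by blast
    then show False using stuck[of "shift g v n L"] fan_path_class[OF colg L(1,3)] L(2) g(2,3) by metis
  qed
  \<comment> \<open>Otherwise cutting the fan at \<open>x\<close> and choosing \<open>c\<close>
    there gives a path.\<close>
  have disj: "c \<notin> missing E k f v" if xc: "x \<in> set ws" "c \<in> missing E k f x" for x c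
  proof
    assume c: "c \<in> missing E k f v"
    obtain us vs where split: "ws = us @ x # vs" using split_list[OF xc(1)] by blast
    have "fan E k f v (m(x := c)) (us @ [x])"
      by (rule fan_cong[OF fan_prefix[OF ws(1)[unfolded split]]])
        (use xc ws(1) split in \<open>auto simp: fan_def\<close>)
    moreover have "hd (us @ [x]) = w" using ws(2) split by (cases us) auto
    ultimately show False using nopath[of f "m(x := c)" "us @ [x]"] c by simp
  qed
  define z where "z = last ws"
  define c where "c = m z"
  have z: "z \<in> set ws" "c \<in> missing E k f z"
    using ws(1) by (auto simp: z_def c_def fan_def)
  have cv: "c \<notin> missing E k f v" by (rule disj[OF z])
  have ac: "a \<noteq> c" using a cv by blast
  obtain y where y: "{v, y} \<in> E" "f {v, y} = c"
    using not_missing[OF missing_range[OF z(2)] cv] edge_at by metis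
  have "y \<in> set ws"
  proof (rule ccontr)
    assume "y \<notin> set ws"
    then have "P (ws @ [y])"
      using ws y m[OF y(1)] by (auto simp: P_def fan_def successively_append_iff c_def z_def)
    then show False using max[of "ws @ [y]"] by simp
  qed
  then obtain us vs where split: "ws = us @ y # vs" by (meson split_list)
  have "y = w"
  proof (rule ccontr)
    assume "y \<noteq> w"
    then obtain us' u where us: "us = us' @ [u]"
      using split ws(2) by (cases us rule: rev_cases) auto
    have split': "ws = us' @ u # y # vs" using split us by simp
    have mu: "m u = c"
      using ws(1) y(2) unfolding split' by (auto simp: fan_def successively_append_iff)
    have uw: "u \<in> set ws" and uz: "u \<noteq> z" using split' dist by (auto simp: z_def)
    have tc: "f {v, w} \<noteq> c" "f {v, w} \<noteq> a"
      using colouring_at_eq[OF f vw y(1)] y(2) \<open>y \<noteq> w\<close> missingD[OF a vw] by auto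
    \<comment> \<open>A further vertex choosing \<open>c\<close> would be followed by an edge
      coloured \<open>c\<close>, but \<open>{v, y}\<close> is the only one at \<open>v\<close>, and
      it comes right after \<open>u\<close>.\<close>
    have only_u: "x = u" if x: "x \<in> set ws" "m x = c" "x \<noteq> z" for x
    proof (rule ccontr)
      assume "x \<noteq> u"
      consider "x \<in> set us'" | "x \<in> set (y # vs)" using x(1) \<open>x \<noteq> u\<close> split' by auto
      then show False
      proof cases
        case 1
        then have "x \<in> set (us' @ [u])" "x \<noteq> last (us' @ [u])" using \<open>x \<noteq> u\<close> by simp_all
        then obtain y' where y': "y' \<in> set (us' @ [u])" "m x = f {v, y'}"
          by (rule fan_succ[OF fan_prefix[OF ws(1)[unfolded split']]])
        then have "y' = y"
          using colouring_at_eq[OF f wsE y(1), of y'] x(2) y(2) split' by auto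
        then show False using y'(1) dist split' by auto
      next
        case 2
        have "x \<noteq> last (y # vs)" using x(3) split by (simp add: z_def)
        with 2 obtain y' where y': "y' \<in> set (y # vs)" "y' \<noteq> hd (y # vs)" "m x = f {v, y'}"
          by (rule fan_succ[OF fan_suffix[OF ws(1)[unfolded split]]])
        then show False
          using colouring_at_eq[OF f wsE y(1), of y'] x(2) y(2) split by auto
      qed
    qed
    let ?B = "bicomponent E f a c"
    have vu: "v \<noteq> u" "v \<noteq> z" using edge_neq wsE uw z(1) by blast+
    have mc: "c \<in> missing E k f u" using ws(1) uw mu by (auto simp: fan_def)
    \<comment> \<open>\<open>v\<close> misses \<open>a\<close>, while \<open>u\<close> and
      \<open>z\<close> miss \<open>c\<close>: these would be three ends of one chain.\<close>
    have notboth: "\<not> (u \<in> ?B v \<and> z \<in> ?B v)"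
      using bicomponent_ends[OF f, of a v c u z] a mc z(2) vu uz by blast
    \<comment> \<open>One of \<open>u\<close> and \<open>z\<close> has a chain avoiding
      \<open>v\<close>. If it is \<open>u\<close>, the fan is cut there and \<open>z\<close> is
      absent; otherwise the fan is kept whole, and \<open>u\<close> is on the chain of
      \<open>v\<close>, not on that of \<open>z\<close>.\<close>
    obtain x L where x: "m x = c" "v \<notin> ?B x" and L: "fan E k f v m L" "hd L = w" "last L = x"
      and others: "\<And>x'. x' \<in> set L \<Longrightarrow> x' \<noteq> x \<Longrightarrow> m x' = c \<Longrightarrow> x' \<notin> ?B x"
      and sub: "set L \<subseteq> set ws"
    proof (cases "u \<in> ?B v")
      case False
      show ?thesis
      proof (rule that)
        show "fan E k f v m (us' @ [u])" using fan_prefix ws(1) split' by metis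
        show "hd (us' @ [u]) = w" using ws(2) split' by (cases us') auto
        show "x' \<notin> ?B u" if "x' \<in> set (us' @ [u])" "x' \<noteq> u" "m x' = c" for x'
        proof -
          have "z \<in> set (y # vs)" using split' last_in_set[of "y # vs"] by (simp add: z_def)
          then have "x' \<noteq> z" using that(1) split' dist by auto
          then show ?thesis using only_u[of x'] that split' by auto
        qed
        show "v \<notin> ?B u" using False bicomponent_sym by metis
      qed (use mu split' in auto)
    next
      case True
      then have "z \<notin> ?B v" using notboth by blast
      then have "u \<notin> ?B z" using True bicomponent_sym bicomponent_trans by metis
      show ?thesis
      proof (rule that)
        show "x' \<notin> ?B z" if "x' \<in> set ws" "x' \<noteq> z" "m x' = c" for x'
          using only_u that \<open>u \<notin> ?B z\<close> by blast
        show "v \<notin> ?B z" using \<open>z \<notin> ?B v\<close> bicomponent_sym by metis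
      qed (use ws in \<open>auto simp: z_def c_def\<close>)
    qed
    define g where "g = vertex_swap E a c (?B x) f"
    have cl: "closed_for E f a c (?B x)" by (rule closed_bicomponent)
    have acr: "a \<in> {1..k}" "c \<in> {1..k}" using missing_range a z(2) by metis+
    have g: "kempe_reachable E k f g"
      unfolding g_def by (rule reachable_vertex_swap[OF f cl acr ac])
    have gv: "g e = f e" if "e \<in> E" "v \<in> e" for e
      unfolding g_def using vertex_swap_at[OF cl that] x(2) by simp
    have Lm: "m x' \<in> missing E k f x'" if "x' \<in> set L" for x' using L(1) that by (simp add: fan_def)
    have xL: "x \<in> set L" using L(1,3) by (auto simp: fan_def)
    \<comment> \<open>The swap makes \<open>a\<close> missing at \<open>x\<close>, and
      \<open>v\<close> misses it as well, so \<open>L\<close> becomes a path.\<close>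
    have "fan E k g v (m(x := a)) L"
    proof (rule fan_cong[OF L(1)])
      fix x' assume x': "x' \<in> set L"
      show "g {v, x'} = f {v, x'}" using gv wsE sub x' by auto
      have "m x' \<noteq> a" using disj[of x' "m x'"] sub x' Lm[OF x'] a by auto
      then show "(m(x := a)) x' \<in> missing E k g x'"
        using missing_vertex_swap_in[OF cl bicomponent_self acr, of a] Lm[OF x'] Lm[OF xL] x(1)
          missing_vertex_swap_other[OF cl, of "m x'"] missing_vertex_swap_out[OF cl others[OF x']]
        by (cases "x' = x"; cases "m x' = c") (auto simp: g_def)
    qed (use L(3) in auto)
    moreover have "a \<in> missing E k g v"
      unfolding g_def using missing_vertex_swap_out[OF cl x(2)] a by simp
    moreover have "g e = f {v, w} \<longleftrightarrow> f e = f {v, w}" for e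
      using tc by (auto simp: g_def vertex_swap_def transpose_def)
    ultimately show False using nopath[of g "m(x := a)" L] L(2,3) g gv[OF vw] by simp
  qed
  then show ?thesis using that[OF ws] y(2) by (simp add: c_def z_def)
qed

section \<open>Fans around both ends of an edge\<close>

text \<open>
  At least one of the two cycles through the edge \<open>{v, w}\<close> can be shifted: if the chain from
  \<open>last ws\<close> in the colours \<open>m v\<close>, \<open>f {v, w}\<close> reaches \<open>v\<close>, then the one from \<open>last xs\<close> does not. After
  swapping the latter, the chain of \<open>w\<close> in the colours \<open>m v\<close>, \<open>m w\<close> misses \<open>last xs\<close> or \<open>v\<close>, so
  that \<open>fan_cycle\<close> applies at \<open>w\<close> or at \<open>v\<close>.
\<close>

lemma twin_fans:
  assumes f: "edge_colouring E k f" and tri: "triangle_free E"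
    and ws: "fan E k f v m ws" "hd ws = w" "m (last ws) = f {v, w}"
    and xs: "fan E k f w m xs" "hd xs = v" "m (last xs) = f {v, w}"
  shows "kempe_reachable E k f (shift f v m ws) \<or> kempe_reachable E k f (shift f w m xs)"
proof -
  define t where "t = f {v, w}"
  define a where "a = m v"
  define b where "b = m w"
  define p where "p = last ws"
  define q where "q = last xs"
  have wsE: "{v, x} \<in> E" "m x \<in> missing E k f x" if "x \<in> set ws" for x
    using ws(1) that by (auto simp: fan_def)
  have xsE: "{w, x} \<in> E" "m x \<in> missing E k f x" if "x \<in> set xs" for x
    using xs(1) that by (auto simp: fan_def)
  have mem: "w \<in> set ws" "p \<in> set ws" "v \<in> set xs" "q \<in> set xs"
    using ws(1,2) xs(1,2) hd_in_set last_in_set by (auto simp: fan_def p_def q_def)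
  have vw: "{v, w} \<in> E" using wsE mem by blast
  have av: "a \<in> missing E k f v" and bw: "b \<in> missing E k f w"
    using wsE xsE mem by (auto simp: a_def b_def)
  have mp: "m p = t" "t \<in> missing E k f p" and mq: "m q = t" "t \<in> missing E k f q"
    using ws(3) xs(3) wsE(2)[OF mem(2)] xsE(2)[OF mem(4)] by (auto simp: p_def q_def t_def)
  have neq: "p \<noteq> v" "p \<noteq> w" "q \<noteq> v" "q \<noteq> w" "v \<noteq> w"
    using missingD[OF mp(2) vw] missingD[OF mq(2) vw] edge_neq[OF vw] by (auto simp: t_def)
  \<comment> \<open>A common last vertex would form a triangle with \<open>v\<close> and
    \<open>w\<close>.\<close>
  have pq: "p \<noteq> q"
    using tri vw wsE(1)[OF mem(2)] xsE(1)[OF mem(4)] unfolding triangle_free_def by metis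
  have col: "a \<in> {1..k}" "t \<in> {1..k}" "a \<noteq> t"
    using missing_range[OF av] missing_range[OF mp(2)] missingD[OF av vw] by (auto simp: t_def)
  have mws: "m x \<noteq> a" "x \<noteq> p \<Longrightarrow> m x \<noteq> t" if "x \<in> set ws" for x
    using fan_colour_neq[OF f ws(1) that] av ws(2) mp col by (auto simp: p_def t_def)
  show ?thesis
  proof (cases "v \<in> bicomponent E f a t p")
    case False
    then show ?thesis
      using fan_cycle[OF f ws(1) _ av] ws(2,3) mp(1) by (simp add: p_def t_def)
  next
    case True
    define C where "C = bicomponent E f a t q"
    define g where "g = vertex_swap E a t C f"
    have cl: "closed_for E f a t C" unfolding C_def by (rule closed_bicomponent)
    have qC: "q \<in> C" by (simp add: C_def bicomponent_self)
    have pv: "p \<in> bicomponent E f a t v" using True by (rule bicomponent_sym)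
    \<comment> \<open>\<open>v\<close> misses \<open>a\<close>, while \<open>p\<close> and
      \<open>q\<close> miss \<open>t\<close>, so these three cannot share a chain, and
      \<open>v\<close> is already with \<open>p\<close>.\<close>
    have vC: "v \<notin> C"
    proof
      assume "v \<in> C"
      then have "q \<in> bicomponent E f a t v" unfolding C_def by (rule bicomponent_sym)
      then show False
        using bicomponent_ends[OF f, of a v t p q] av mp mq neq pq pv by blast
    qed
    have pC: "p \<notin> C"
      using vC True bicomponent_trans unfolding C_def by blast
    have wC: "w \<notin> C"
      using vC closed_forD[OF cl vw, of w v] by (auto simp: t_def)
    have g: "kempe_reachable E k f g"
      unfolding g_def by (rule reachable_vertex_swap[OF f cl col])
    have colg: "edge_colouring E k g" by (rule edge_colouring_reachable[OF g f])
    have gv: "g e = f e" if "e \<in> E" "x \<in> e" "x \<notin> C" for e x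
      unfolding g_def using vertex_swap_at[OF cl that(1,2)] that(3) by simp
    have clg: "closed_for E g a t C" unfolding g_def closed_for_vertex_swap by (rule cl)
    have avg: "a \<in> missing E k g v" and bwg: "b \<in> missing E k g w"
      using missing_vertex_swap_out[OF cl] vC wC av bw by (simp_all add: g_def)
    have aqg: "a \<in> missing E k g q"
      using missing_vertex_swap_in[OF cl qC col(1,2)] mq(2) by (simp add: g_def)
    have gg: "vertex_swap E a t C g = f" by (simp add: g_def)
    show ?thesis
    proof (cases "w \<in> bicomponent E g a b q")
      case True
      then have qw: "q \<in> bicomponent E g a b w" by (rule bicomponent_sym)
      have vB: "v \<notin> bicomponent E g a b w"
        using bicomponent_ends[OF colg, of a w b q v] qw avg bwg aqg neq by blast
      obtain ys where split: "ws = w # ys" using ws(1,2) by (cases ws) (auto simp: fan_def)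
      have ys: "ys \<noteq> []" "last ys = p" using neq(2) split by (auto simp: p_def split: if_splits)
      have mg: "m x \<in> missing E k g x" if "x \<in> set ws" for x
      proof (cases "x = p")
        case True
        then show ?thesis
          using missing_vertex_swap_out[OF cl pC] wsE(2)[OF that] by (simp add: g_def)
      next
        case False
        then show ?thesis
          using missing_vertex_swap_other[OF cl] mws[OF that] wsE(2)[OF that] by (simp add: g_def)
      qed
      have "fan E k g v m ws" by (rule fan_cong[OF ws(1)]) (use gv vC wsE mg in auto)
      \<comment> \<open>The cycle is rotated to end at \<open>w\<close>, where the chosen colour is
        \<open>b\<close>: the chain relevant to \<open>fan_cycle\<close> is then the one of
        \<open>w\<close> that avoids \<open>v\<close>.\<close>
      then have "fan E k g v m (ys @ [w])"
        using ys mp gv[OF vw, of v] vC split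
        by (auto simp: fan_def successively_append_iff successively_Cons t_def)
      moreover have "m w = g {v, hd ys}"
        using \<open>fan E k g v m ws\<close> ys(1) split by (auto simp: fan_def successively_Cons)
      ultimately have h: "kempe_reachable E k g (shift g v m (ys @ [w]))" (is "kempe_reachable E k g ?h")
        using fan_cycle[OF colg, of v m "ys @ [w]" a] avg vB ys(1) by (simp add: b_def)
      have colh: "edge_colouring E k ?h" by (rule edge_colouring_reachable[OF h colg])
      have set: "set (ys @ [w]) = set ws" using split by auto
      have clh: "closed_for E ?h a t C"
        unfolding closed_for_def
      proof (intro ballI impI)
        fix e assume e: "e \<in> E" "(?h e = a \<or> ?h e = t) \<and> e \<inter> C \<noteq> {}"
        show "e \<subseteq> C"
        proof (cases rule: shift_cases[where e = e and v = v and ws = "ys @ [w]" and f = g and m = m])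
          case (1 x)
          then have "x = p" using e(2) mws[of x] set by auto
          then show ?thesis using e(2) 1(2) vC pC by auto
        next
          case 2
          then show ?thesis using clg e unfolding closed_for_def by metis
        qed
      qed
      \<comment> \<open>The first swap is undone. No shifted edge is disturbed, as none that meets
        \<open>C\<close> is coloured \<open>a\<close> or \<open>t\<close>.\<close>
      have "vertex_swap E a t C ?h = shift f v m ws"
      proof
        fix e
        show "vertex_swap E a t C ?h e = shift f v m ws e"
        proof (cases rule: shift_cases[where e = e and v = v and ws = "ys @ [w]" and f = g and m = m])
          case (1 x)
          have "x \<in> C \<Longrightarrow> m x \<noteq> a \<and> m x \<noteq> t" using mws[of x] pC 1(1) set by auto
          then have "vertex_swap E a t C ?h e = m x"
            using 1(2,3) vC by (auto simp: vertex_swap_def transpose_def)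
          moreover have "x \<in> set ws" using 1(1) set by blast
          ultimately show ?thesis using shift_in[of x ws f v m] 1(2) by simp
        next
          case 2
          have "vertex_swap E a t C ?h e = vertex_swap E a t C g e"
            unfolding vertex_swap_def 2(2) ..
          moreover have "shift f v m ws e = f e" by (rule shift_notin) (use 2(1) set in blast)
          ultimately show ?thesis using gg by simp
        qed
      qed
      then have "kempe_reachable E k ?h (shift f v m ws)"
        using reachable_vertex_swap[OF colh clh col] by simp
      then show ?thesis using g h kempe_reachable_trans by metis
    next
      case False
      \<comment> \<open>In \<open>g\<close>, \<open>q\<close> misses \<open>a\<close>, the colour of
        the edge after \<open>{w, v}\<close>, so the fan without \<open>v\<close> is itself a
        cycle.\<close>
      define n where "n = m(q := a)"
      obtain ys where split: "xs = v # ys" using xs(1,2) by (cases xs) (auto simp: fan_def)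
      have ys: "ys \<noteq> []" "last ys = q" using neq(3) split by (auto simp: q_def split: if_splits)
      have fan_ys: "fan E k f w m ys" using fan_tl xs(1) split ys(1) by metis
      have aw: "f {w, hd ys} = a" using xs(1) split ys(1) by (auto simp: fan_def successively_Cons a_def)
      have mys: "m x \<noteq> a" "m x \<noteq> t" if "x \<in> set ys" "x \<noteq> q" for x
        using fan_colour_neq(1)[OF f fan_ys that(1)] fan_colour_neq(1)[OF f xs(1), of x] xs(2) that ys(2) aw split
        by (auto simp: q_def t_def insert_commute)
      have fan_g: "fan E k g w n ys"
      proof (rule fan_cong[OF fan_ys])
        show "n x \<in> missing E k g x" if "x \<in> set ys" for x
          using aqg missing_vertex_swap_other[OF cl mys[OF that]] xsE(2)[of x] that split
          by (auto simp: n_def g_def)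
      qed (use gv wC xsE split ys(2) in \<open>auto simp: n_def\<close>)
      have "w \<notin> bicomponent E g b a q" using False bicomponent_commute by metis
      then have h: "kempe_reachable E k g (shift g w n ys)" (is "kempe_reachable E k g ?h")
        using fan_cycle[OF colg fan_g _ bwg] ys aw gv[of "{w, hd ys}" w] wC xsE(1)[of "hd ys"] split
        by (simp add: n_def)
      have colh: "edge_colouring E k ?h" by (rule edge_colouring_reachable[OF h colg])
      \<comment> \<open>Swapping back on \<open>C\<close> together with \<open>v\<close> and
        \<open>w\<close> also turns \<open>{v, w}\<close> from \<open>t\<close> to
        \<open>a = m v\<close>, and \<open>{w, q}\<close> from \<open>a\<close> to
        \<open>t = m q\<close>.\<close>
      let ?D = "insert v (insert w C)"
      have off: "g e \<noteq> a \<and> g e \<noteq> t"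
        if e: "e \<in> E" "v \<in> e \<or> w \<in> e" "e \<noteq> {v, w}" "\<And>x. x \<in> set ys \<Longrightarrow> e \<noteq> {w, x}" for e
      proof -
        have "g e = f e" using e(1,2) gv vC wC by blast
        moreover have "f e \<noteq> t"
          using edge_colouringD[OF f e(1) vw] e(2,3) by (auto simp: t_def)
        moreover have "f e \<noteq> a"
        proof
          assume fa: "f e = a"
          then have "w \<in> e" using e(1,2) missingD[OF av] by blast
          moreover have "hd ys \<in> set ys" using ys(1) by simp
          ultimately show False
            using edge_colouringD[OF f e(1) xsE(1)[of "hd ys"], of w] e(4) fa aw split by auto
        qed
        ultimately show ?thesis by simp
      qed
      have clh: "closed_for E ?h a t ?D"
        unfolding closed_for_def
      proof (intro ballI impI)
        fix e assume e: "e \<in> E" "(?h e = a \<or> ?h e = t) \<and> e \<inter> ?D \<noteq> {}"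
        show "e \<subseteq> ?D"
        proof (cases rule: shift_cases[where e = e and v = w and ws = ys and f = g and m = n])
          case (1 x)
          then have "x = q" using e(2) mys[of x] by (auto simp: n_def split: if_splits)
          then show ?thesis using 1(2) qC by auto
        next
          case 2
          then show ?thesis using clg e off[OF e(1) _ _ 2(1)] unfolding closed_for_def by auto
        qed
      qed
      have "vertex_swap E a t ?D ?h = shift f w m xs"
      proof
        fix e
        show "vertex_swap E a t ?D ?h e = shift f w m xs e"
        proof (cases rule: shift_cases[where e = e and v = w and ws = ys and f = g and m = n])
          case (1 x)
          have "vertex_swap E a t ?D ?h e = transpose a t (n x)"
            using 1 xsE(1)[of x] split by (simp add: vertex_swap_def)
          also have "\<dots> = m x" using mys[OF 1(1)] mq(1) by (auto simp: n_def transpose_def)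
          finally show ?thesis using shift_in[of x xs f w m] 1(1,2) split by simp
        next
          case 2
          have he: "vertex_swap E a t ?D ?h e = vertex_swap E a t ?D g e"
            unfolding vertex_swap_def 2(2) ..
          show ?thesis
          proof (cases "e = {v, w}")
            case True
            then have "vertex_swap E a t ?D g e = a"
              using gv[OF vw, of v] vC vw by (simp add: vertex_swap_def t_def)
            then show ?thesis using he shift_in[of v xs f w m] True split
              by (simp add: a_def insert_commute)
          next
            case False
            then have "vertex_swap E a t ?D g e = f e"
              using off[of e, OF _ _ False 2(1)] gv[of e] vC wC
              by (auto simp: vertex_swap_def g_def transpose_def)
            moreover have "shift f w m xs e = f e"
              by (rule shift_notin) (use 2(1) split False in \<open>auto simp: insert_commute\<close>)
            ultimately show ?thesis using he by simp
          qed
        qed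
      qed
      then have "kempe_reachable E k ?h (shift f w m xs)"
        using reachable_vertex_swap[OF colh clh col] by simp
      then show ?thesis using g h kempe_reachable_trans by metis
    qed
  qed
qed

text \<open>
  After shifting the cycle at \<open>v\<close>, the cycle at \<open>w\<close> has become a path; shifting it turns the
  reversed cycle at \<open>v\<close> into a path, whose shift restores the edges at \<open>v\<close>. No other vertex lies in
  both fans, as there are no triangles.
\<close>

lemma twin_fans_switch:
  assumes f: "edge_colouring E k f" and tri: "triangle_free E"
    and ws: "fan E k f v m ws" "hd ws = w" "m (last ws) = f {v, w}"
    and xs: "fan E k f w m xs" "hd xs = v" "m (last xs) = f {v, w}"
    and g: "kempe_reachable E k f (shift f v m ws)"
  shows "kempe_reachable E k f (shift f w m xs)"
proof -
  define t where "t = f {v, w}"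
  define g' where "g' = shift f v m ws"
  define h where "h = shift g' w m xs"
  \<comment> \<open>The old colours, which the last shift is to restore at \<open>v\<close>.\<close>
  define n where "n x = f {v, x}" for x
  have wsE: "{v, x} \<in> E" "m x \<in> missing E k f x" if "x \<in> set ws" for x
    using ws(1) that by (auto simp: fan_def)
  have xsE: "{w, x} \<in> E" "m x \<in> missing E k f x" if "x \<in> set xs" for x
    using xs(1) that by (auto simp: fan_def)
  have mem: "w \<in> set ws" "last ws \<in> set ws" "v \<in> set xs" "last xs \<in> set xs"
    using ws(1,2) xs(1,2) hd_in_set last_in_set by (auto simp: fan_def)
  have vw: "{v, w} \<in> E" "v \<noteq> w" using wsE mem edge_neq by blast+
  have disj: "x \<notin> set ws \<or> x \<notin> set xs" for x
    using tri vw wsE xsE unfolding triangle_free_def by metis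
  have dist: "distinct ws" "distinct xs" using ws(1) xs(1) by (auto simp: fan_def)
  have av: "m v \<in> missing E k f v" and bw: "m w \<in> missing E k f w"
    using wsE xsE mem by auto
  obtain ys where split: "ws = w # ys" using ws(1,2) by (cases ws) (auto simp: fan_def)
  have ys: "ys \<noteq> []" using ws(3) split bw vw missingD[OF bw vw(1)] by auto
  have fan_ys: "fan E k f v m ys" using fan_tl ws(1) split ys by metis
  have bf: "f {v, hd ys} = m w" using ws(1) split ys by (auto simp: fan_def successively_Cons)
  have colg: "edge_colouring E k g'" unfolding g'_def by (rule edge_colouring_reachable[OF g f])
  have g1: "g' {v, x} = m x" if "x \<in> set ws" for x using shift_in that by (simp add: g'_def)
  have g2: "g' e = f e" if "\<And>x. x \<in> set ws \<Longrightarrow> e \<noteq> {v, x}" for e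
    unfolding g'_def by (rule shift_notin[OF that])
  have mws: "m x \<noteq> m v" if "x \<in> set ws" for x
    using fan_colour_neq(2)[OF f ws(1) that] av missingD[OF av vw(1)] ws(3) by (cases "x = last ws") auto
  have fan_g: "fan E k g' w m xs"
  proof (rule fan_cong[OF xs(1)])
    fix x assume x: "x \<in> set xs"
    show "g' {w, x} = f {w, x}" if "x \<noteq> hd xs"
      by (rule g2) (use that xs(2) vw in \<open>auto simp: doubleton_eq_iff\<close>)
    show "m x \<in> missing E k g' x"
    proof (cases "x = v")
      case True
      have "g' e \<noteq> m v" if e: "e \<in> E" "v \<in> e" for e
      proof (cases "\<exists>x\<in>set ws. e = {v, x}")
        case True
        then show ?thesis using g1 mws by auto
      next
        case False
        then show ?thesis using g2[of e] missingD[OF av e] by auto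
      qed
      then show ?thesis using True av by (auto simp: missing_def)
    next
      case False
      have "missing E k g' x = missing E k f x"
        by (rule missing_cong, rule g2) (use False disj[of x] x in auto)
      then show ?thesis using xsE(2)[OF x] by simp
    qed
  qed simp
  \<comment> \<open>The first shift gave \<open>{v, w}\<close> the colour \<open>m w\<close>, which
    frees its old colour at \<open>w\<close>.\<close>
  have tw: "m (last xs) \<in> missing E k g' w"
  proof -
    have "g' e \<noteq> t" if e: "e \<in> E" "w \<in> e" for e
    proof (cases "e = {v, w}")
      case True
      then show ?thesis using g1[OF mem(1)] missingD[OF bw vw(1)] by (auto simp: t_def)
    next
      case False
      then have "g' e = f e" using e(2) vw by (intro g2) auto
      then show ?thesis using edge_colouringD[OF f e(1) vw(1) e(2)] False by (auto simp: t_def)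
    qed
    then show ?thesis using edge_colouring_range[OF f vw(1)] xs(3) by (auto simp: missing_def t_def)
  qed
  have h: "kempe_reachable E k g' h" unfolding h_def by (rule fan_path(1)[OF colg fan_g tw])
  have colh: "edge_colouring E k h" by (rule edge_colouring_reachable[OF h colg])
  have h1: "h {w, x} = m x" if "x \<in> set xs" for x using shift_in that by (simp add: h_def)
  have h2: "h e = g' e" if "\<And>x. x \<in> set xs \<Longrightarrow> e \<noteq> {w, x}" for e
    unfolding h_def by (rule shift_notin[OF that])
  have wys: "w \<notin> set ys" using dist split by simp
  have h3: "h {v, x} = m x" if "x \<in> set ys" for x
    using h2[of "{v, x}"] g1[of x] that split wys vw by (auto simp: doubleton_eq_iff)
  \<comment> \<open>In \<open>h\<close>, \<open>{v, x}\<close> has the old colour of its successor,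
    so the reversed list is a fan. The vertex \<open>w\<close> is left out, as \<open>{v, w}\<close>
    already has its final colour \<open>m v\<close>.\<close>
  have fan_h: "fan E k h v n (rev ys)"
    unfolding fan_def
  proof (intro conjI ballI)
    show "successively (\<lambda>x y. h {v, y} = n x) (rev ys)"
      unfolding successively_rev
      by (rule successively_mono_last[of "\<lambda>x y. f {v, y} = m x"])
        (use fan_ys h3 in \<open>auto simp: fan_def n_def\<close>)
  next
    fix x assume "x \<in> set (rev ys)"
    then have x: "x \<in> set ys" "x \<in> set ws" using split by auto
    have xE: "{v, x} \<in> E" "x \<noteq> v" using wsE(1)[OF x(2)] edge_neq by blast+
    show "{v, x} \<in> E" by fact
    have "h e \<noteq> n x" if e: "e \<in> E" "x \<in> e" for e
    proof (cases "e = {v, x}")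
      case True
      then show ?thesis using h3[OF x(1)] missingD[OF wsE(2)[OF x(2)] xE(1)] by (simp add: n_def)
    next
      case False
      have "h e = g' e" by (rule h2) (use e(2) disj[of x] x wys in auto)
      also have "\<dots> = f e" by (rule g2) (use e(2) False xE in auto)
      finally show ?thesis using edge_colouringD[OF f e(1) xE(1) e(2)] False by (auto simp: n_def)
    qed
    then show "n x \<in> missing E k h x"
      using edge_colouring_range[OF f xE(1)] by (auto simp: missing_def n_def)
  qed (use ys dist split in auto)
  \<comment> \<open>The last vertex is \<open>hd ys\<close>, whose old colour \<open>m w\<close> is
    free at \<open>v\<close> since the second shift recoloured \<open>{v, w}\<close>.\<close>
  have nb: "n (last (rev ys)) \<in> missing E k h v"
  proof -
    have hd: "hd ys \<in> set ys" "hd ys \<in> set ws" using ys split by auto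
    have "h e \<noteq> m w" if e: "e \<in> E" "v \<in> e" for e
    proof (cases "e = {v, w}")
      case True
      then have "h e = m v" using h1[OF mem(3)] by (simp add: insert_commute)
      then show ?thesis using missingD[OF av wsE(1)[OF hd(2)]] bf by simp
    next
      case False
      have he: "h e = g' e" by (rule h2) (use e(2) False vw in auto)
      show ?thesis
      proof (cases "\<exists>x\<in>set ys. e = {v, x}")
        case True
        then obtain x where x: "x \<in> set ys" "e = {v, x}" by blast
        have "m x \<noteq> m w"
        proof (cases "x = last ys")
          case True
          then have "m x = f {v, w}" using ws(3) split ys by simp
          then show ?thesis using colouring_at_eq[OF f vw(1) wsE(1)[OF hd(2)]] wys hd(1) bf by auto
        next
          case False
          then show ?thesis using fan_colour_neq(1)[OF f fan_ys x(1)] bf by simp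
        qed
        then show ?thesis using h3[OF x(1)] x(2) by simp
      next
        case no: False
        then have "g' e = f e" using False split by (intro g2) auto
        then show ?thesis
          using edge_colouringD[OF f e(1) wsE(1)[OF hd(2)] e(2)] no hd(1) he bf by auto
      qed
    qed
    then show ?thesis
      using missing_range[OF bw] ys bf by (auto simp: missing_def n_def last_rev)
  qed
  have "shift h v n (rev ys) = shift f w m xs"
  proof
    fix e
    show "shift h v n (rev ys) e = shift f w m xs e"
    proof (cases rule: shift_cases[where e = e and v = v and ws = "rev ys" and f = h and m = n])
      case (1 x)
      have "shift f w m xs e = f e"
        by (rule shift_notin) (use 1 wys vw in \<open>auto simp: doubleton_eq_iff\<close>)
      then show ?thesis using 1 by (simp add: n_def)
    next
      case 2
      show ?thesis
      proof (cases "\<exists>x\<in>set xs. e = {w, x}")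
        case True
        then show ?thesis using 2(2) h1 shift_in[of _ xs f w m] by auto
      next
        case False
        then have "e \<noteq> {v, w}" using mem(3) by (auto simp: insert_commute)
        then have "h e = f e" using h2[of e] g2[of e] False 2(1) split by auto
        then show ?thesis using 2(2) shift_notin[of xs e w f m] False by auto
      qed
    qed
  qed
  then have "kempe_reachable E k h (shift f w m xs)" using fan_path(1)[OF colh fan_h nb] by simp
  then show ?thesis using g h kempe_reachable_trans unfolding g'_def by metis
qed

section \<open>Reaching a prescribed colour class\<close>

text \<open>By contradiction, \<open>f\<close> is taken to be lexicographically minimal among the
  reachable colourings. The hypothesis \<open>missing\<close> makes the choice of \<open>m\<close>
  possible, and \<open>covered\<close> supplies the bad edge at a vertex missing only
  \<open>t\<close>.\<close>

lemma decrease_step: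
  fixes M k t
  defines "ugly \<equiv> \<lambda>f. card {e \<in> E - M. f e = t}" and "bad \<equiv> \<lambda>f. card {e \<in> M. f e \<noteq> t}"
  assumes tri: "triangle_free E"
    and M: "M \<subseteq> E" "\<And>e e'. e \<in> M \<Longrightarrow> e' \<in> M \<Longrightarrow> e \<inter> e' \<noteq> {} \<Longrightarrow> e = e'"
    and t: "t \<in> {1..k}"
    and missing: "\<And>f v. edge_colouring E k f \<Longrightarrow> missing E k f v \<noteq> {}"
    and covered: "\<And>f v. edge_colouring E k f \<Longrightarrow> missing E k f v = {t} \<Longrightarrow> \<exists>e\<in>M. v \<in> e"
    and f: "edge_colouring E k f" and ne: "{e \<in> E. f e = t} \<noteq> M"
  obtains g where "kempe_reachable E k f g"
    "ugly g < ugly f \<or> ugly g \<le> ugly f \<and> bad g < bad f"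
proof (rule ccontr)
  assume no: "\<not> thesis"
  note better = that
  have min: False if "kempe_reachable E k f g"
    "ugly g < ugly f \<or> ugly g \<le> ugly f \<and> bad g < bad f" for g
    using better[OF that] no by blast
  have finM: "finite M" using M(1) finite_E by (rule finite_subset)
  have flip: False
    if g: "kempe_reachable E k f g" "ugly g \<le> ugly f" "bad g \<le> bad f"
      and e: "{x, y} \<in> M" "g {x, y} \<noteq> t" "t \<in> missing E k g x" "t \<in> missing E k g y" for g x y
  proof -
    let ?h = "g({x, y} := t)"
    have "kempe_reachable E k f ?h"
      using recolour_edge(1)[OF edge_colouring_reachable[OF g(1) f] _ e(3,4)] e(1) M(1) g(1)
        kempe_reachable_trans by blast
    moreover have "{e \<in> E - M. ?h e = t} = {e \<in> E - M. g e = t}" using e(1) by auto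
    moreover have "{e \<in> M. ?h e \<noteq> t} \<subset> {e \<in> M. g e \<noteq> t}" using e(1,2) by auto
    then have "bad ?h < bad g" unfolding bad_def using finM by (intro psubset_card_mono) auto
    ultimately show False using min[of ?h] g(2,3) by (simp add: ugly_def)
  qed
  \<comment> \<open>The colour \<open>t\<close> is chosen only where nothing else is missing, so a
    cycle closing with \<open>t\<close> ends at a vertex missing only \<open>t\<close>. One choice
    serves both fans, as \<open>twin_fans\<close> demands.\<close>
  define m where "m x = (if missing E k f x = {t} then t else SOME c. c \<in> missing E k f x \<and> c \<noteq> t)" for x
  have "\<exists>c. c \<in> missing E k f x \<and> c \<noteq> t" if "missing E k f x \<noteq> {t}" for x
    using missing[OF f, of x] that by blast
  then have m_some: "m x \<in> missing E k f x \<and> m x \<noteq> t" if "missing E k f x \<noteq> {t}" for x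
    unfolding m_def using someI_ex[of "\<lambda>c. c \<in> missing E k f x \<and> c \<noteq> t"] that by simp
  have m1: "m x \<in> missing E k f x" for x
    using m_some[of x] by (cases "missing E k f x = {t}") (auto simp: m_def)
  have m2: "missing E k f x = {t}" if "m x = t" for x
    using m_some that by blast
  \<comment> \<open>The fan must close: taking just the ugly edge out of the class of
    \<open>t\<close> would leave fewer ugly edges.\<close>
  have cycle: thesis'
    if vw: "{v, w} \<in> E - M" "f {v, w} = t"
      and K: "\<And>ws. fan E k f v m ws \<Longrightarrow> hd ws = w \<Longrightarrow> m (last ws) = f {v, w} \<Longrightarrow> thesis'"
    for v w thesis'
  proof (rule fan_dichotomy[OF f, of v w "m v" m])
    fix g assume g: "kempe_reachable E k f g"
    show "\<exists>e\<in>E. \<not> (g e = f {v, w} \<longleftrightarrow> f e = f {v, w} \<and> e \<noteq> {v, w})"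
    proof (rule ccontr)
      assume "\<not> ?thesis"
      then have "\<And>e. e \<in> E \<Longrightarrow> g e = t \<longleftrightarrow> f e = t \<and> e \<noteq> {v, w}" using vw(2) by metis
      then have eq: "{e \<in> E - M. g e = t} = {e \<in> E - M. f e = t} - {{v, w}}" by blast
      have "ugly g < ugly f"
        unfolding ugly_def eq by (rule card_Diff1_less) (use vw finite_E in simp_all)
      then show False using min[OF g] by blast
    qed
  qed (use vw m1 K in auto)
  show False
  proof (cases "{e \<in> E - M. f e = t} = {}")
    case True
    then obtain e where e: "e \<in> M" "f e \<noteq> t" using ne M(1) by auto
    obtain x y where xy: "e = {x, y}" using card_E e(1) M(1) by (metis card_2_iff subsetD)
    \<comment> \<open>Without ugly edges, all edges coloured \<open>t\<close> lie in the matching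
      \<open>M\<close>, so both ends of a bad edge miss \<open>t\<close>.\<close>
    have "t \<in> missing E k f z" if "z \<in> e" for z
    proof (rule ccontr)
      assume "t \<notin> missing E k f z"
      with t obtain e' where e': "e' \<in> E" "z \<in> e'" "f e' = t" by (rule not_missing)
      then have "e' \<in> M" using True by blast
      then show False using M(2)[of e e'] e e' that by blast
    qed
    then show False using flip[of f x y] e xy by simp
  next
    case False
    then obtain e0 where e0: "e0 \<in> E - M" "f e0 = t" by blast
    then obtain v0 w0 where "e0 = {v0, w0}" using card_E by (metis DiffD1 card_2_iff)
    with e0 have "{v0, w0} \<in> E - M" "f {v0, w0} = t" by simp_all
    then obtain s where s: "missing E k f s = {t}" using cycle m2 by metis
    obtain e where e: "e \<in> M" "s \<in> e" using covered[OF f s] by blast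
    obtain v where sv: "e = {s, v}" "s \<noteq> v" by (rule edge_at[OF subsetD[OF M(1) e(1)] e(2)])
    have ts: "f e' \<noteq> t" if "e' \<in> E" "s \<in> e'" for e' using missingD[of t E k f s e'] s that by simp
    have svE: "{s, v} \<in> E" "{s, v} \<in> M" "f {s, v} \<noteq> t" using e sv M(1) ts by auto
    have "t \<notin> missing E k f v" using flip[of f s v] svE s by auto
    with t obtain e' where e': "e' \<in> E" "v \<in> e'" "f e' = t" by (rule not_missing)
    obtain w where w: "e' = {v, w}" "v \<noteq> w" by (rule edge_at[OF e'(1,2)])
    have vwM: "{v, w} \<notin> M"
    proof
      assume "{v, w} \<in> M"
      then have "{s, v} = {v, w}" by (rule M(2)[OF svE(2)]) simp
      then show False using svE(3) e'(3) w(1) by simp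
    qed
    have vw: "{v, w} \<in> E - M" "f {v, w} = t" using e' w vwM by auto
    then have wv: "{w, v} \<in> E - M" "f {w, v} = t" by (simp_all add: insert_commute)
    obtain ws where ws: "fan E k f v m ws" "hd ws = w" "m (last ws) = f {v, w}" by (rule cycle[OF vw])
    obtain xs where xs: "fan E k f w m xs" "hd xs = v" "m (last xs) = f {w, v}" by (rule cycle[OF wv])
    have xs3: "m (last xs) = f {v, w}" using xs(3) by (simp add: insert_commute)
    let ?g = "shift f w m xs"
    have g: "kempe_reachable E k f ?g"
      using twin_fans[OF f tri ws xs(1,2) xs3] twin_fans_switch[OF f tri ws xs(1,2) xs3] by blast
    define q where "q = last xs"
    have xsE: "{w, x} \<in> E" if "x \<in> set xs" for x using xs(1) that by (auto simp: fan_def)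
    have q: "q \<in> set xs" "missing E k f q = {t}"
      using xs(1,3) m2 wv(2) by (auto simp: q_def fan_def)
    have qv: "q \<noteq> v" using q(2) vw missingD[of t E k f v "{v, w}"] by auto
    \<comment> \<open>In the class of \<open>t\<close>, the shift replaces \<open>{v, w}\<close> by
      \<open>{w, q}\<close>, since within the cycle only \<open>q\<close> chooses
      \<open>t\<close>.\<close>
    have gt: "?g e = t \<longleftrightarrow> f e = t \<and> e \<noteq> {v, w} \<or> e = {w, q}" if "e \<in> E" for e
    proof (cases rule: shift_cases[where e = e and v = w and ws = xs and f = f and m = m])
      case (1 x)
      have "m x = t \<longleftrightarrow> x = q"
        using fan_colour_neq(1)[OF f xs(1) 1(1)] xs(2,3) wv(2) by (auto simp: q_def)
      moreover have "f e = t \<Longrightarrow> e = {v, w}"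
        using colouring_at_eq[OF f xsE[OF 1(1)], of v] wv 1(2) by auto
      ultimately show ?thesis using 1 by (auto simp: doubleton_eq_iff)
    next
      case 2
      have "v \<in> set xs" using xs(1,2) by (auto simp: fan_def)
      then have "e \<noteq> {v, w}" "e \<noteq> {w, q}" using 2(1) q(1) by (auto simp: insert_commute)
      then show ?thesis using 2(2) by simp
    qed
    have "t \<in> missing E k ?g v"
    proof -
      have "?g e \<noteq> t" if "e \<in> E" "v \<in> e" for e
        using gt[OF that(1)] edge_colouringD[OF f that(1) e'(1) that(2) e'(2)] e'(3) w that(2) qv by auto
      then show ?thesis using t by (simp add: missing_def)
    qed
    moreover have "t \<in> missing E k ?g s"
    proof -
      have "s \<noteq> w" using ts[OF e'(1)] w e'(3) by auto
      moreover have "s \<noteq> q"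
        using tri svE(1) vw(1) xsE[OF q(1)] unfolding triangle_free_def by (metis DiffD1 insert_commute)
      ultimately have "?g e \<noteq> t" if "e \<in> E" "s \<in> e" for e
        using gt[OF that(1)] ts[OF that] that(2) by auto
      then show ?thesis using t by (simp add: missing_def)
    qed
    moreover have "ugly ?g \<le> ugly f"
    proof -
      let ?U = "{e \<in> E - M. f e = t}"
      have fin: "finite ?U" using finite_E by simp
      \<comment> \<open>The edge \<open>{w, q}\<close> may be ugly too, but at most makes up for the
        loss of \<open>{v, w}\<close>.\<close>
      have "{e \<in> E - M. ?g e = t} \<subseteq> insert {w, q} (?U - {{v, w}})" using gt by auto
      then have "ugly ?g \<le> card (insert {w, q} (?U - {{v, w}}))"
        unfolding ugly_def using fin by (intro card_mono) auto
      also have "\<dots> \<le> Suc (card (?U - {{v, w}}))" by (rule card_insert_le_m1) simp_all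
      also have "\<dots> = ugly f" unfolding ugly_def by (rule card_Suc_Diff1[OF fin]) (use vw in simp)
      finally show ?thesis .
    qed
    moreover have "bad ?g \<le> bad f"
    proof -
      have "{e \<in> M. ?g e \<noteq> t} \<subseteq> {e \<in> M. f e \<noteq> t}" using gt M(1) vwM by blast
      then show ?thesis unfolding bad_def using finM by (intro card_mono) auto
    qed
    moreover have "?g {s, v} \<noteq> t" using missingD[OF calculation(1) svE(1)] by simp
    ultimately show False using flip[OF g _ _ svE(2)] by blast
  qed
qed

lemma reachable_colour_class:
  assumes "triangle_free E"
    and "M \<subseteq> E" "\<And>e e'. e \<in> M \<Longrightarrow> e' \<in> M \<Longrightarrow> e \<inter> e' \<noteq> {} \<Longrightarrow> e = e'"
    and "t \<in> {1..k}"
    and "\<And>f v. edge_colouring E k f \<Longrightarrow> missing E k f v \<noteq> {}"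
    and "\<And>f v. edge_colouring E k f \<Longrightarrow> missing E k f v = {t} \<Longrightarrow> \<exists>e\<in>M. v \<in> e"
    and "edge_colouring E k f"
  obtains g where "kempe_reachable E k f g" "{e \<in> E. g e = t} = M"
proof -
  let ?ms = "[\<lambda>f. card {e \<in> E - M. f e = t}, \<lambda>f. card {e \<in> M. f e \<noteq> t}]"
  have "\<exists>g. kempe_reachable E k f g \<and> {e \<in> E. g e = t} = M"
    using assms(7)
  proof (induction f rule: wf_induct_rule[OF wf_measures[of ?ms]])
    case (1 f)
    show ?case
    proof (cases "{e \<in> E. f e = t} = M")
      case False
      obtain g where g: "kempe_reachable E k f g"
        "card {e \<in> E - M. g e = t} < card {e \<in> E - M. f e = t} \<or>
         card {e \<in> E - M. g e = t} \<le> card {e \<in> E - M. f e = t} \<and>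
         card {e \<in> M. g e \<noteq> t} < card {e \<in> M. f e \<noteq> t}"
        by (rule decrease_step[OF assms(1-6) 1(2) False])
      then have "(g, f) \<in> measures ?ms" by auto
      then show ?thesis
        using 1(1)[of g] edge_colouring_reachable[OF g(1) 1(2)] g(1) kempe_reachable_trans by blast
    qed (use kempe_reachable_refl in blast)
  qed
  then show ?thesis using that by blast
qed

end

section \<open>Induction on the number of colours\<close>

text \<open>Chains in colours up to \<open>k\<close> do not see \<open>M\<close>, whose edges all
  carry the larger colour \<open>t\<close>.\<close>

lemma kempe_reachable_extend:
  assumes "kempe_reachable (E - M) k f g" "k < t" "M \<subseteq> E"
  shows "kempe_reachable E t (\<lambda>e. if e \<in> M then t else f e) (\<lambda>e. if e \<in> M then t else g e)"
  using assms(1) unfolding kempe_reachable_def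
proof (induction rule: rtranclp_induct)
  case (step g h)
  let ?ext = "\<lambda>f e. if e \<in> M then t else f e"
  obtain c d K where cd: "c \<in> {1..k}" "d \<in> {1..k}" "c \<noteq> d"
    and K: "kempe_chain (E - M) g c d K" and h: "h = kempe_swap c d K g"
    using step(2) unfolding kempe_change_def by blast
  have "bicoloured_edges E (?ext g) c d = bicoloured_edges (E - M) g c d"
    using cd assms(2) by (auto simp: bicoloured_edges_def)
  then have K': "kempe_chain E (?ext g) c d K" using K by (simp add: kempe_chain_def)
  have "K \<subseteq> E - M" using K by (auto simp: kempe_chain_def bicoloured_edges_def Let_def)
  then have "?ext h = kempe_swap c d K (?ext g)"
    unfolding h by (intro ext) (auto simp: kempe_swap_def)
  moreover have "c \<in> {1..t}" "d \<in> {1..t}" using cd assms(2) by auto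
  ultimately have "kempe_change E t (?ext g) (?ext h)"
    unfolding kempe_change_def using K' cd(3) by blast
  then show ?case using step(3) by simp
qed simp

lemma fin_graph_subset:
  assumes "fin_graph E" "E' \<subseteq> E"
  shows "fin_graph E'"
  using assms unfolding fin_graph_def by (auto intro: finite_subset)

lemma edge_colouring_inj_on:
  assumes "edge_colouring E k f"
  shows "inj_on f {e \<in> E. v \<in> e}"
  using edge_colouringD[OF assms] by (auto intro!: inj_onI)

text \<open>An arbitrary \<open>d\<close> below \<open>k\<close> replaces the chromatic index, about
  which nothing need be known after a class is removed.\<close>

lemma kempe_reachable_triangle_free:
  assumes "fin_graph E" "triangle_free E" "edge_colouring E d g" "edge_colouring E k f" "d < k"
  shows "kempe_reachable E k f g"
  using assms
proof (induction d arbitrary: E g f k)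
  case 0
  \<comment> \<open>Without colours there are no edges, and extensionality leaves a single
    colouring.\<close>
  have "E = {}" using edge_colouring_range[OF "0.prems"(3)] by fastforce
  then have "f = g" using "0.prems"(3,4) by (simp add: edge_colouring_def)
  then show ?case by simp
next
  case (Suc d)
  interpret fin_graph E by fact
  define M where "M = {e \<in> E. g e = Suc d}"
  have k: "Suc d < k" by fact
  have gE: "g e \<in> {1..Suc d}" if "e \<in> E" for e by (rule edge_colouring_range[OF Suc.prems(3) that])
  have deg: "card {e \<in> E. v \<in> e} \<le> n" if "\<And>e. e \<in> E \<Longrightarrow> v \<in> e \<Longrightarrow> g e \<in> {1..n}" for v n
  proof -
    have "g ` {e \<in> E. v \<in> e} \<subseteq> {1..n}" using that by blast
    then show ?thesis using card_inj_on_le[OF edge_colouring_inj_on[OF Suc.prems(3)], of v "{1..n}"] by simp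
  qed
  have miss: "card {c \<in> {1..k}. c \<notin> missing E k f' v} \<le> card {e \<in> E. v \<in> e}" for f' v
  proof -
    have "{c \<in> {1..k}. c \<notin> missing E k f' v} \<subseteq> f' ` {e \<in> E. v \<in> e}" by (auto simp: missing_def)
    then show ?thesis using finite_E by (auto intro: surj_card_le)
  qed
  have M1: "M \<subseteq> E" by (auto simp: M_def)
  have M2: "e = e'" if ee': "e \<in> M" "e' \<in> M" "e \<inter> e' \<noteq> {}" for e e'
  proof -
    obtain x where "x \<in> e" "x \<in> e'" using ee'(3) by blast
    then show ?thesis using edge_colouringD[OF Suc.prems(3), of e e' x] ee'(1,2) by (simp add: M_def)
  qed
  have t: "k \<in> {1..k}" using k by simp
  have nonempty: "missing E k f' v \<noteq> {}" for f' v
  proof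
    assume "missing E k f' v = {}"
    then have "{c \<in> {1..k}. c \<notin> missing E k f' v} = {1..k}" by auto
    then have "k \<le> card {e \<in> E. v \<in> e}" using miss[of f' v] by simp
    also have "\<dots> \<le> Suc d" by (rule deg) (rule gE)
    finally show False using k by simp
  qed
  \<comment> \<open>A vertex missing only \<open>k\<close> has at least \<open>k - 1 > d\<close>
    edges, too many for the first \<open>d\<close> colours of \<open>g\<close>.\<close>
  have covered: "\<exists>e\<in>M. v \<in> e" if "missing E k f' v = {k}" for f' v
  proof (rule ccontr)
    assume no: "\<not> ?thesis"
    have "{c \<in> {1..k}. c \<notin> missing E k f' v} = {1..k - 1}" unfolding that by auto
    then have "k - 1 \<le> card {e \<in> E. v \<in> e}" using miss[of f' v] by simp
    moreover have "g e \<in> {1..d}" if "e \<in> E" "v \<in> e" for e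
      using gE[OF that(1)] no that by (auto simp: M_def le_Suc_eq)
    then have "card {e \<in> E. v \<in> e} \<le> d" by (rule deg)
    ultimately show False using k by simp
  qed
  obtain \<alpha> where \<alpha>: "kempe_reachable E k f \<alpha>" "{e \<in> E. \<alpha> e = k} = M"
    by (rule reachable_colour_class[OF Suc.prems(2) M1 M2 t _ _ Suc.prems(4)])
      (use nonempty covered in simp_all)
  have col\<alpha>: "edge_colouring E k \<alpha>" by (rule edge_colouring_reachable[OF \<alpha>(1) Suc.prems(4)])
  let ?E = "E - M"
  let ?ext = "\<lambda>f e. if e \<in> M then k else f e"
  have sub: "edge_colouring ?E j (restrict f' ?E)"
    if "edge_colouring E i f'" "\<And>e. e \<in> ?E \<Longrightarrow> f' e \<in> {1..j}" for i j f'
    using that unfolding edge_colouring_def by auto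
  have "kempe_reachable ?E (k - 1) (restrict \<alpha> ?E) (restrict g ?E)"
  proof (rule Suc.IH)
    show "fin_graph ?E" using fin_graph_subset[OF Suc.prems(1)] by blast
    show "triangle_free ?E" using Suc.prems(2) unfolding triangle_free_def by blast
    show "edge_colouring ?E d (restrict g ?E)"
      by (rule sub[OF Suc.prems(3)]) (use gE in \<open>fastforce simp: M_def le_Suc_eq\<close>)
    show "edge_colouring ?E (k - 1) (restrict \<alpha> ?E)"
    proof (rule sub[OF col\<alpha>])
      fix e assume "e \<in> ?E"
      then have "\<alpha> e \<in> {1..k}" "\<alpha> e \<noteq> k" using edge_colouring_range[OF col\<alpha>] \<alpha>(2) by auto
      then show "\<alpha> e \<in> {1..k - 1}" by auto
    qed
    show "d < k - 1" using k by simp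
  qed
  then have "kempe_reachable E k (?ext (restrict \<alpha> ?E)) (?ext (restrict g ?E))"
    by (rule kempe_reachable_extend) (use k M1 in auto)
  moreover have "?ext (restrict \<alpha> ?E) = \<alpha>"
    using \<alpha>(2) col\<alpha> unfolding edge_colouring_def by (fastforce simp: PiE_iff extensional_def)
  moreover have "?ext (restrict g ?E) = ?ext g"
    using Suc.prems(3) unfolding edge_colouring_def by (fastforce simp: PiE_iff extensional_def)
  ultimately have r: "kempe_reachable E k f (?ext g)" using \<alpha>(1) kempe_reachable_trans by metis
  have "vertex_swap E k (Suc d) UNIV (?ext g) = g"
  proof
    fix e
    consider "e \<in> M" | "e \<in> E - M" | "e \<notin> E" by blast
    then show "vertex_swap E k (Suc d) UNIV (?ext g) e = g e"
    proof cases
      case 1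
      then have "e \<in> E" "g e = Suc d" "e \<noteq> {}" using card_E by (fastforce simp: M_def)+
      then show ?thesis using 1 by (simp add: vertex_swap_def)
    next
      case 2
      then show ?thesis using gE[of e] k by (auto simp: vertex_swap_def transpose_def M_def)
    next
      case 3
      then show ?thesis using M1 by (auto simp: vertex_swap_def)
    qed
  qed
  moreover have "closed_for E (?ext g) k (Suc d) UNIV" by (simp add: closed_for_def)
  ultimately have "kempe_reachable E k (?ext g) g"
    using reachable_vertex_swap[OF edge_colouring_reachable[OF r Suc.prems(4)], of k "Suc d" UNIV] k by simp
  then show ?case using r kempe_reachable_trans by metis
qed

theorem theorem1p6:
  fixes V :: "'a set" and E :: "'a set set" and k :: nat
    and f g :: "'a set \<Rightarrow> nat"
  assumes "simple_graph V E"
    and "triangle_free E"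
    and "k > chromatic_index E"
    and "edge_colouring E k f"
    and "edge_colouring E (chromatic_index E) g"
  shows "kempe_reachable E k f g"
proof (rule kempe_reachable_triangle_free)
  have "E \<subseteq> Pow V" "finite V" using assms(1) by (auto simp: simple_graph_def)
  then have "finite E" by (meson finite_Pow_iff finite_subset)
  then show "fin_graph E" using assms(1) by (auto simp: fin_graph_def simple_graph_def)
qed (use assms in auto)

end
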